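(* Let $Q$ be a real-valued function on $\mathbf{R}^+=[0,\infty)$. If $Q(x^2)-\rho x^2$ is convex on $\mathbf{R}$ (as a function of $x\in\mathbf{R}$) with a constant $\rho>0$, then $$W(\hat\mu,\hat\mu_Q)\le\sqrt{\frac{1}{2\rho}\,\widetilde{\Sigma}_Q^+(\mu)}$$ for every compactly supported Borel probability measure $\mu\in\mathcal{M}(\mathbf{R}^+)$, where $\mu_Q$ is the minimizer of $\widetilde{\Sigma}_Q^+$ on $\mathcal{M}(\mathbf{R}^+)$ and $\hat\mu_Q$ denotes the image of $\mu_Q$ under the transformation $\mu\mapsto\hat\mu$.
   Context: $\mathcal{M}(\mathbf{R}^+)$ is the set of Borel probability measures on $\mathbf{R}^+=[0,\infty)$. The bijection $\mu\in\mathcal{M}(\mathbf{R}^+)\mapsto\hat\mu\in\mathcal{M}(\mathbf{R}^+)$ is defined by $\mu(F)=\hat\mu(\{x\in\mathbf{R}^+:x^2\in F\})$ for Borel $F\subset\mathbf{R}^+$ (i.e. $\hat\mu$ is the push-forward of $\mu$ under $x\mapsto\sqrt{x}$). Wasserstein distance: $W(\mu,\nu):=\inf_{\pi\in\Pi(\mu,\nu)}\sqrt{\iint\frac12(x-y)^2\,d\pi(x,y)}$, where $\Pi(\mu,\nu)$ is the set of probability measures on the product space with marginals $\mu$ and $\nu$. Free entropy: $\Sigma(\mu):=\iint\log|x-y|\,d\mu(x)\,d\mu(y)$. Relative free entropy on $\mathbf{R}^+$: for a real-valued continuous $Q$ on $\mathbf{R}^+$ with $\lim_{x\to+\infty}x\exp(-\varepsilon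 Q(x))=0$ for every $\varepsilon>0$ (automatic under the hypothesis of the claim), $$\widetilde{\Sigma}_Q^+(\mu):=-\Sigma(\mu)+\int_{\mathbf{R}^+}Q(x)\,d\mu(x)+B^+(Q),$$ $$B^+(Q):=\lim_{n\to\infty}\frac1{n^2}\log\int\cdots\int_{(\mathbf{R}^+)^n}\exp\Bigl(-n\sum_{i=1}^nQ(x_i)\Bigr)\prod_{i<j}(x_i-x_j)^2\prod_{i=1}^ndx_i,$$ the limit existing and being finite; $\widetilde{\Sigma}_Q^+$ is nonnegative on $\mathcal{M}(\mathbf{R}^+)$ with a unique zero $\mu_Q$, so that $B^+(Q)=-\min_{\mu\in\mathcal{M}(\mathbf{R}^+)}\bigl(-\Sigma(\mu)+\int Q\,d\mu\bigr)$. *)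

theory Defs
  imports "HOL-Probability.Probability"
begin

abbreviation borel_nonneg :: "real measure" where
  "borel_nonneg \<equiv> restrict_space borel {0..}"

definition prob_measures_nonneg :: "real measure set" where
  "prob_measures_nonneg = {\<mu>. prob_space \<mu> \<and> sets \<mu> = sets borel_nonneg}"

definition compactly_supported :: "real measure \<Rightarrow> bool" where
  "compactly_supported \<mu> \<longleftrightarrow> (\<exists>K. compact K \<and> (AE x in \<mu>. x \<in> K))"

definition hat :: "real measure \<Rightarrow> real measure" where
  "hat \<mu> = distr \<mu> borel_nonneg sqrt"

text \<open>The equation that characterises the transformation.\<close>

lemma emeasure_hat:
  assumes "\<mu> \<in> prob_measures_nonneg" "F \<in> sets borel_nonneg"
  shows "emeasure \<mu> F = emeasure (hat \<mu>) {x \<in> {0..}. x\<^sup>2 \<in> F}"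
proof -
  have sets: "sets \<mu> = sets borel_nonneg" and sp: "space \<mu> = {0..}"
    using assms(1) sets_eq_imp_space_eq[of \<mu> borel_nonneg]
    by (auto simp: prob_measures_nonneg_def space_restrict_space)
  have F: "F \<subseteq> {0..}"
    using sets.sets_into_space[OF assms(2)] by (simp add: space_restrict_space)
  have sqrt_meas: "sqrt \<in> measurable \<mu> borel_nonneg"
    unfolding measurable_cong_sets[OF sets refl]
    by (intro measurable_restrict_space3) auto
  have sq_meas: "(\<lambda>x. x\<^sup>2) \<in> measurable borel_nonneg (borel_nonneg :: real measure)"
    by (intro measurable_restrict_space3) auto
  have "{x \<in> {0..}. x\<^sup>2 \<in> F} \<in> sets borel_nonneg"
    using measurable_sets[OF sq_meas assms(2)]
    by (simp add: space_restrict_space vimage_def Int_def conj_commute)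
  then have "emeasure (hat \<mu>) {x \<in> {0..}. x\<^sup>2 \<in> F}
      = emeasure \<mu> (sqrt -` {x \<in> {0..}. x\<^sup>2 \<in> F} \<inter> space \<mu>)"
    unfolding hat_def by (rule emeasure_distr[OF sqrt_meas])
  also have "sqrt -` {x \<in> {0..}. x\<^sup>2 \<in> F} \<inter> space \<mu> = F"
    using F by (auto simp: sp)
  finally show ?thesis by simp
qed

text \<open>The value outside \<open>[0, \<infinity>]\<close> plays no role.\<close>

definition ereal_sqrt :: "ereal \<Rightarrow> ereal" where
  "ereal_sqrt a = (if a = \<infinity> then \<infinity> else ereal (sqrt (real_of_ereal a)))"

definition couplings :: "real measure \<Rightarrow> real measure \<Rightarrow> (real \<times> real) measure set" where
  "couplings \<mu> \<nu> = {\<pi>. prob_space \<pi> \<and> sets \<pi> = sets (\<mu> \<Otimes>\<^sub>M \<nu>) \<and>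
     distr \<pi> \<mu> fst = \<mu> \<and> distr \<pi> \<nu> snd = \<nu>}"

definition wasserstein :: "real measure \<Rightarrow> real measure \<Rightarrow> ereal" where
  "wasserstein \<mu> \<nu> = (INF \<pi>\<in>couplings \<mu> \<nu>.
     ereal_sqrt (enn2ereal (\<integral>\<^sup>+ (x, y). ennreal (1 / 2 * (x - y)\<^sup>2) \<partial>\<pi>)))"

text \<open>The Bochner integral assigns \<open>0\<close> to non-integrable functions, while the integrals below
  may be infinite. The extended integral is the integral of the positive part minus that of the
  negative part (\<open>e2ennreal\<close> sends negative values to \<open>0\<close>).\<close>

definition ext_integral :: "'a measure \<Rightarrow> ('a \<Rightarrow> ereal) \<Rightarrow> ereal" where
  "ext_integral M f =
     enn2ereal (\<integral>\<^sup>+ x. e2ennreal (f x) \<partial>M) - enn2ereal (\<integral>\<^sup>+ x. e2ennreal (- f x) \<partial>M)"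

text \<open>\<open>log |x - y|\<close> is \<open>-\<infinity>\<close> on the diagonal, whereas \<open>ln 0 = 0\<close> in HOL.\<close>

definition log_dist :: "real \<Rightarrow> real \<Rightarrow> ereal" where
  "log_dist x y = (if x = y then - \<infinity> else ereal (ln \<bar>x - y\<bar>))"

definition free_entropy :: "real measure \<Rightarrow> ereal" where
  "free_entropy \<mu> = ext_integral (\<mu> \<Otimes>\<^sub>M \<mu>) (\<lambda>(x, y). log_dist x y)"

definition partition_function_nonneg :: "(real \<Rightarrow> real) \<Rightarrow> nat \<Rightarrow> real" where
  "partition_function_nonneg Q n =
     (\<integral>x. exp (- real n * (\<Sum>i<n. Q (x i))) * (\<Prod>j<n. \<Prod>i<j. (x i - x j)\<^sup>2)
        \<partial>(\<Pi>\<^sub>M i\<in>{..<n}. restrict_space lborel {0..}))"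

definition B_nonneg :: "(real \<Rightarrow> real) \<Rightarrow> real" where
  "B_nonneg Q = lim (\<lambda>n. 1 / (real n)\<^sup>2 * ln (partition_function_nonneg Q n))"

text \<open>If \<open>log |x - y|\<close> has a non-integrable positive part under \<open>\<mu> \<Otimes>\<^sub>M \<mu>\<close>, then \<open>log (1 + x)\<close> is
  not \<open>\<mu>\<close>-integrable, and under the growth condition on \<open>Q\<close> the integral of \<open>Q\<close> is \<open>\<infinity>\<close>. Since
  \<open>-\<infinity> + \<infinity> = \<infinity>\<close> in \<^typ>\<open>ereal\<close>, the functional is then \<open>\<infinity>\<close>, which is the value of the double integral of
  \<open>(Q x + Q y) / 2 - log |x - y|\<close> (plus the constant).\<close>

definition rel_free_entropy_nonneg :: "(real \<Rightarrow> real) \<Rightarrow> real measure \<Rightarrow> ereal" where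
  "rel_free_entropy_nonneg Q \<mu> =
     - free_entropy \<mu> + ext_integral \<mu> (\<lambda>x. ereal (Q x)) + ereal (B_nonneg Q)"

end

theory Submission
  imports Defs
begin

text \<open>
  Substitute \<open>x = y\<^sup>2\<close>. For a probability measure \<open>\<nu>\<close> on the half-line write
  \<open>J \<nu>\<close> for the integral of \<open>Q\<close> minus the double integral of \<open>ln |x - y|\<close>. In the new
  variable the external field \<open>y \<mapsto> Q (y\<^sup>2)\<close> is strongly convex with modulus \<open>\<rho>\<close>, and the
  interaction \<open>- ln |y\<^sup>2 - z\<^sup>2| = - ln |y - z| - ln (y + z)\<close> is convex along any motion that preserves
  the order of the particles. Hence \<open>J\<close> is strongly displacement convex: move the square root of
  one measure to the square root of another along the monotone coupling, which is built from quantile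
  functions (lemma \<open>displacement_convexity\<close>). At a minimiser \<open>\<nu>\<close> this gives
  \<open>\<rho> \<cdot> E (Y - Z)\<^sup>2 \<le> J \<mu> - J \<nu>\<close> for the monotone coupling \<open>(Y, Z)\<close>, and any coupling
  bounds the Wasserstein distance from above (lemma \<open>transport_inequality\<close>).

  It remains to show \<open>- J \<nu> \<le> B_nonneg Q\<close> (lemma \<open>B_nonneg_ge_minus_energy\<close>). Since \<open>B_nonneg Q\<close> is
  the value of \<open>lim\<close>, this includes convergence. Both come from the minimal energies \<open>m n\<close> of
  \<open>n\<close>-point configurations. Deleting a point shows that \<open>m n / (n (n - 1))\<close> increases, averaging over
  independent samples of \<open>\<nu>\<close> shows that it is at most \<open>J \<nu>\<close>, and the logarithm of the partition
  function is \<open>- m n\<close> up to an error \<open>o(n\<^sup>2)\<close>. The lower bound in the last claim comes from a small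
  box around a contracted and slightly shifted copy of an arbitrary configuration; convexity controls \<open>Q\<close>
  on the box uniformly in the configuration.
\<close>

section \<open>The external field\<close>

text \<open>The hypothesis on \<open>Q\<close> says that \<open>y \<mapsto> Q (y\<^sup>2)\<close> is strongly convex; being even as well, it
  increases on the half-line and grows at least quadratically.\<close>

locale sqrt_strongly_convex =
  fixes Q :: "real \<Rightarrow> real" and \<rho> :: real
  assumes rho_pos: "\<rho> > 0"
    and convex: "convex_on UNIV (\<lambda>x. Q (x\<^sup>2) - \<rho> * x\<^sup>2)"
begin

lemma strongly_convex:
  assumes "0 \<le> t" "t \<le> 1"
  shows "Q (((1 - t) * a + t * b)\<^sup>2) \<le> (1 - t) * Q (a\<^sup>2) + t * Q (b\<^sup>2) - \<rho> * t * (1 - t) * (a - b)\<^sup>2"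
proof -
  have "Q (((1 - t) * a + t * b)\<^sup>2) - \<rho> * ((1 - t) * a + t * b)\<^sup>2
      \<le> (1 - t) * (Q (a\<^sup>2) - \<rho> * a\<^sup>2) + t * (Q (b\<^sup>2) - \<rho> * b\<^sup>2)"
    using convex_onD[OF convex assms, of a b] by simp
  then show ?thesis
    by (simp add: power2_eq_square algebra_simps)
qed

text \<open>\<open>sqrt x\<close> is a convex combination of \<open>- sqrt y\<close> and \<open>sqrt y\<close>, at which the even convex function
  takes the same value \<open>Q y\<close>.\<close>

lemma Q_mono:
  assumes "0 \<le> x" "x \<le> y"
  shows "Q x \<le> Q y"
proof (cases "y = 0")
  case False
  define b where "b = sqrt y"
  define t where "t = (sqrt x / b + 1) / 2"
  have b: "b > 0" "b\<^sup>2 = y" using assms False by (auto simp: b_def)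
  have "sqrt x \<le> b" using assms by (simp add: b_def)
  then have t: "0 \<le> t" "t \<le> 1" using b assms by (auto simp: t_def field_simps)
  have "(1 - t) * (- b) + t * b = sqrt x" using b by (simp add: t_def field_simps)
  then have "Q x \<le> (1 - t) * Q y + t * Q y - \<rho> * t * (1 - t) * (- b - b)\<^sup>2"
    using strongly_convex[OF t, of "- b" b] b assms by simp
  moreover have "\<rho> * t * (1 - t) * (- b - b)\<^sup>2 \<ge> 0" using t rho_pos by simp
  ultimately show ?thesis by (simp add: algebra_simps)
qed (use assms in auto)

text \<open>Midpoint convexity at \<open>sqrt x\<close> and \<open>- sqrt x\<close>.\<close>

lemma Q_growth:
  assumes "0 \<le> x"
  shows "Q 0 + \<rho> * x \<le> Q x"
  using convex_onD[OF convex, of "1/2" "sqrt x" "- sqrt x"] assms by simp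

lemma Q_measurable [measurable]: "Q \<in> borel_measurable borel_nonneg"
proof -
  have "continuous_on UNIV (\<lambda>x. (Q (x\<^sup>2) - \<rho> * x\<^sup>2) + \<rho> * x\<^sup>2)"
    by (intro continuous_intros convex_on_continuous[OF _ convex]) auto
  then have [measurable]: "(\<lambda>x. Q (x\<^sup>2)) \<in> borel_measurable borel"
    by (simp add: borel_measurable_continuous_onI)
  have "(\<lambda>x. Q ((sqrt x)\<^sup>2)) \<in> borel_measurable borel_nonneg"
    by (intro measurable_restrict_space1) measurable
  then show ?thesis
    by (subst measurable_cong[of _ _ "\<lambda>x. Q ((sqrt x)\<^sup>2)"]) (auto simp: space_restrict_space)
qed

end

section \<open>Finite logarithmic energy\<close>

text \<open>The functional without its constant, as a real number. It is meaningful only under the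
  condition \<open>finite_energy\<close>, which also excludes mass on the diagonal, where \<open>ln 0 = 0\<close> would
  hide an infinite energy.\<close>

definition energy :: "(real \<Rightarrow> real) \<Rightarrow> real measure \<Rightarrow> real" where
  "energy Q \<nu> = (\<integral>x. Q x \<partial>\<nu>) - (\<integral>z. ln \<bar>fst z - snd z\<bar> \<partial>(\<nu> \<Otimes>\<^sub>M \<nu>))"

definition finite_energy :: "(real \<Rightarrow> real) \<Rightarrow> real measure \<Rightarrow> bool" where
  "finite_energy Q \<nu> \<longleftrightarrow> integrable \<nu> Q \<and> integrable (\<nu> \<Otimes>\<^sub>M \<nu>) (\<lambda>z. ln \<bar>fst z - snd z\<bar>) \<and>
     (AE z in \<nu> \<Otimes>\<^sub>M \<nu>. fst z \<noteq> snd z)"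

lemma prob_measures_nonnegD:
  assumes "\<nu> \<in> prob_measures_nonneg"
  shows "prob_space \<nu>" "sets \<nu> = sets borel_nonneg" "space \<nu> = {0..}"
    "(\<lambda>x. x) \<in> borel_measurable \<nu>"
proof -
  show 1: "prob_space \<nu>" "sets \<nu> = sets borel_nonneg"
    using assms by (auto simp: prob_measures_nonneg_def)
  show "space \<nu> = {0..}"
    using sets_eq_imp_space_eq[OF 1(2)] by (simp add: space_restrict_space)
  have "(\<lambda>x. x) \<in> borel_measurable borel_nonneg"
    by (intro measurable_restrict_space1) simp
  then show "(\<lambda>x. x) \<in> borel_measurable \<nu>"
    unfolding measurable_cong_sets[OF 1(2) refl] .
qed

lemma ext_integral_eq_integral:
  assumes "integrable M f" "AE x in M. F x = ereal (f x)"
  shows "ext_integral M F = ereal (\<integral>x. f x \<partial>M)"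
proof -
  have "(\<integral>\<^sup>+ x. e2ennreal (F x) \<partial>M) = (\<integral>\<^sup>+ x. ennreal (f x) \<partial>M)"
    using assms(2) by (intro nn_integral_cong_AE) (auto simp: e2ennreal_ereal)
  moreover have "(\<integral>\<^sup>+ x. e2ennreal (- F x) \<partial>M) = (\<integral>\<^sup>+ x. ennreal (- f x) \<partial>M)"
    using assms(2) by (intro nn_integral_cong_AE) (auto simp: e2ennreal_ereal)
  moreover have "enn2ereal p - enn2ereal q = ereal (enn2real p - enn2real q)"
    if "p \<noteq> \<infinity>" "q \<noteq> \<infinity>" for p q
    using that by (cases p; cases q) (auto simp: enn2ereal_ennreal)
  ultimately show ?thesis
    using assms(1) by (simp add: ext_integral_def real_lebesgue_integral_def real_integrable_def)
qed

lemma rel_free_entropy_eq_energy: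
  assumes "finite_energy Q \<nu>"
  shows "rel_free_entropy_nonneg Q \<nu> = ereal (energy Q \<nu> + B_nonneg Q)"
proof -
  have "free_entropy \<nu> = ereal (\<integral>z. ln \<bar>fst z - snd z\<bar> \<partial>(\<nu> \<Otimes>\<^sub>M \<nu>))"
    unfolding free_entropy_def using assms
    by (intro ext_integral_eq_integral) (auto simp: finite_energy_def log_dist_def split_beta)
  moreover have "ext_integral \<nu> (\<lambda>x. ereal (Q x)) = ereal (\<integral>x. Q x \<partial>\<nu>)"
    using assms by (intro ext_integral_eq_integral) (auto simp: finite_energy_def)
  ultimately show ?thesis
    by (simp add: rel_free_entropy_nonneg_def energy_def)
qed

lemma (in pair_prob_space)
  fixes f :: "'a \<Rightarrow> real"
  assumes "integrable M1 f"
  shows integrable_compose_fst: "integrable (M1 \<Otimes>\<^sub>M M2) (\<lambda>z. f (fst z))"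
    and integral_compose_fst: "(\<integral>z. f (fst z) \<partial>(M1 \<Otimes>\<^sub>M M2)) = (\<integral>x. f x \<partial>M1)"
proof -
  show "integrable (M1 \<Otimes>\<^sub>M M2) (\<lambda>z. f (fst z))"
    using assms by (intro integrable_distr[OF measurable_fst]) (simp add: M2.distr_pair_fst)
  show "(\<integral>z. f (fst z) \<partial>(M1 \<Otimes>\<^sub>M M2)) = (\<integral>x. f x \<partial>M1)"
    using integral_distr[OF measurable_fst, of f M1 M2] assms by (simp add: M2.distr_pair_fst)
qed

lemma (in pair_prob_space)
  fixes f :: "'b \<Rightarrow> real"
  assumes "integrable M2 f"
  shows integrable_compose_snd: "integrable (M1 \<Otimes>\<^sub>M M2) (\<lambda>z. f (snd z))"
    and integral_compose_snd: "(\<integral>z. f (snd z) \<partial>(M1 \<Otimes>\<^sub>M M2)) = (\<integral>x. f x \<partial>M2)"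
proof -
  interpret Y: pair_prob_space M2 M1 ..
  show *: "integrable (M1 \<Otimes>\<^sub>M M2) (\<lambda>z. f (snd z))"
    using Y.integrable_compose_fst[OF assms]
    by (subst integrable_product_swap_iff[symmetric]) (simp add: case_prod_beta')
  show "(\<integral>z. f (snd z) \<partial>(M1 \<Otimes>\<^sub>M M2)) = (\<integral>x. f x \<partial>M2)"
    using integral_product_swap[of "\<lambda>z. f (snd z)"] * Y.integral_compose_fst[OF assms]
    by (simp add: case_prod_beta')
qed

context sqrt_strongly_convex
begin

lemma integrable_identity:
  assumes \<nu>: "\<nu> \<in> prob_measures_nonneg" and Q: "integrable \<nu> Q"
  shows "integrable \<nu> (\<lambda>x. x)"
proof -
  note [measurable] = prob_measures_nonnegD(4)[OF \<nu>]
  interpret prob_space \<nu> by (rule prob_measures_nonnegD[OF \<nu>])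
  have "integrable \<nu> (\<lambda>x. (Q x - Q 0) / \<rho>)" using Q by auto
  then show ?thesis
  proof (rule Bochner_Integration.integrable_bound)
    have "x \<le> (Q x - Q 0) / \<rho>" if "x \<ge> 0" for x
      using Q_growth[OF that] rho_pos by (simp add: field_simps)
    then show "AE x in \<nu>. norm x \<le> norm ((Q x - Q 0) / \<rho>)"
      by (intro AE_I2) (auto simp: prob_measures_nonnegD[OF \<nu>] simp del: abs_divide intro: order_trans[OF _ abs_ge_self])
  qed measurable
qed

text \<open>The growth of \<open>Q\<close> makes the confinement dominate: if \<open>Q\<close> has infinite integral, the functional is
  infinite. Otherwise the mean is finite, so the positive part of \<open>ln |x - y| \<le> x + y\<close> is
  integrable, and finiteness of the functional controls the negative part.\<close>

lemma finite_energy_if_rel_free_entropy_finite: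
  assumes \<nu>: "\<nu> \<in> prob_measures_nonneg" and fin: "rel_free_entropy_nonneg Q \<nu> \<noteq> \<infinity>"
  shows "finite_energy Q \<nu>"
proof -
  note D = prob_measures_nonnegD[OF \<nu>]
  note [measurable] = D(4)
  interpret prob_space \<nu> by (rule D)
  interpret P: pair_prob_space \<nu> \<nu> ..
  have [measurable]: "Q \<in> borel_measurable \<nu>"
    using Q_measurable unfolding measurable_cong_sets[OF D(2) refl] .
  have [measurable]: "fst \<in> borel_measurable (\<nu> \<Otimes>\<^sub>M \<nu>)" "snd \<in> borel_measurable (\<nu> \<Otimes>\<^sub>M \<nu>)"
    using measurable_compose[OF measurable_fst D(4)] measurable_compose[OF measurable_snd D(4)] by auto
  have "(\<integral>\<^sup>+x. ennreal (- Q x) \<partial>\<nu>) \<le> (\<integral>\<^sup>+x. ennreal (- Q 0) \<partial>\<nu>)"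
    using Q_mono by (intro nn_integral_mono) (auto simp: D intro!: ennreal_leI)
  also have "\<dots> < \<infinity>" by (simp add: emeasure_space_1)
  finally have Qneg: "(\<integral>\<^sup>+x. ennreal (- Q x) \<partial>\<nu>) \<noteq> \<infinity>" by simp
  have "(\<integral>\<^sup>+x. ennreal (Q x) \<partial>\<nu>) \<noteq> \<infinity>"
  proof
    assume "(\<integral>\<^sup>+x. ennreal (Q x) \<partial>\<nu>) = \<infinity>"
    then have "ext_integral \<nu> (\<lambda>x. ereal (Q x)) = \<infinity>"
      using Qneg by (cases "\<integral>\<^sup>+x. ennreal (- Q x) \<partial>\<nu>")
        (auto simp: ext_integral_def e2ennreal_ereal enn2ereal_ennreal)
    then show False using fin by (simp add: rel_free_entropy_nonneg_def)
  qed
  with Qneg have Q: "integrable \<nu> Q" by (simp add: real_integrable_def)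
  note X = integrable_identity[OF \<nu> Q]
  have Xfst: "integrable (\<nu> \<Otimes>\<^sub>M \<nu>) fst" and Xsnd: "integrable (\<nu> \<Otimes>\<^sub>M \<nu>) snd"
    using P.integrable_compose_fst[OF X] P.integrable_compose_snd[OF X] by simp_all
  let ?L = "\<lambda>(x, y). log_dist x y"
  have [measurable]: "?L \<in> borel_measurable (\<nu> \<Otimes>\<^sub>M \<nu>)"
    unfolding log_dist_def split_beta by measurable
  have "(\<integral>\<^sup>+z. e2ennreal (?L z) \<partial>(\<nu> \<Otimes>\<^sub>M \<nu>)) \<le> (\<integral>\<^sup>+z. ennreal (fst z + snd z) \<partial>(\<nu> \<Otimes>\<^sub>M \<nu>))"
  proof (intro nn_integral_mono)
    fix z assume "z \<in> space (\<nu> \<Otimes>\<^sub>M \<nu>)"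
    then obtain x y where z: "z = (x, y)" and xy: "0 \<le> x" "0 \<le> y"
      by (auto simp: space_pair_measure D)
    have "ln \<bar>x - y\<bar> \<le> x + y" if "x \<noteq> y"
      using ln_le_minus_one[of "\<bar>x - y\<bar>"] that xy by linarith
    then show "e2ennreal (?L z) \<le> ennreal (fst z + snd z)"
      by (auto simp: z log_dist_def e2ennreal_ereal e2ennreal_neg intro!: ennreal_leI)
  qed
  also have "\<dots> < \<infinity>"
    using Bochner_Integration.integrable_add[OF Xfst Xsnd] by (simp add: real_integrable_def less_top)
  finally have Lpos: "(\<integral>\<^sup>+z. e2ennreal (?L z) \<partial>(\<nu> \<Otimes>\<^sub>M \<nu>)) \<noteq> \<infinity>" by simp
  have Lneg: "(\<integral>\<^sup>+z. e2ennreal (- ?L z) \<partial>(\<nu> \<Otimes>\<^sub>M \<nu>)) \<noteq> \<infinity>"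
  proof
    assume "(\<integral>\<^sup>+z. e2ennreal (- ?L z) \<partial>(\<nu> \<Otimes>\<^sub>M \<nu>)) = \<infinity>"
    then have "free_entropy \<nu> = - \<infinity>"
      using Lpos by (cases "\<integral>\<^sup>+z. e2ennreal (?L z) \<partial>(\<nu> \<Otimes>\<^sub>M \<nu>)")
        (auto simp: free_entropy_def ext_integral_def enn2ereal_ennreal)
    then show False using fin by (simp add: rel_free_entropy_nonneg_def)
  qed
  have "AE z in \<nu> \<Otimes>\<^sub>M \<nu>. e2ennreal (- ?L z) \<noteq> \<infinity>"
    using Lneg by (intro nn_integral_PInf_AE) auto
  then have ne: "AE z in \<nu> \<Otimes>\<^sub>M \<nu>. fst z \<noteq> snd z"
    by eventually_elim (auto simp: log_dist_def split_beta e2ennreal_infty split: if_splits)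
  have "(\<integral>\<^sup>+z. e2ennreal (?L z) \<partial>(\<nu> \<Otimes>\<^sub>M \<nu>)) = (\<integral>\<^sup>+z. ennreal (ln \<bar>fst z - snd z\<bar>) \<partial>(\<nu> \<Otimes>\<^sub>M \<nu>))"
    "(\<integral>\<^sup>+z. e2ennreal (- ?L z) \<partial>(\<nu> \<Otimes>\<^sub>M \<nu>)) = (\<integral>\<^sup>+z. ennreal (- ln \<bar>fst z - snd z\<bar>) \<partial>(\<nu> \<Otimes>\<^sub>M \<nu>))"
    using ne by (auto intro!: nn_integral_cong_AE simp: log_dist_def split_beta e2ennreal_ereal)
  then have "integrable (\<nu> \<Otimes>\<^sub>M \<nu>) (\<lambda>z. ln \<bar>fst z - snd z\<bar>)"
    using Lpos Lneg by (simp add: real_integrable_def)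
  with Q ne show ?thesis by (simp add: finite_energy_def)
qed

end

section \<open>Energies of point configurations\<close>

lemma sum_offdiagonal:
  fixes f :: "nat \<Rightarrow> nat \<Rightarrow> real"
  assumes "\<And>i j. f i j = f j i"
  shows "(\<Sum>i<n. \<Sum>j\<in>{..<n} - {i}. f i j) = 2 * (\<Sum>j<n. \<Sum>i<j. f i j)"
proof (induction n)
  case (Suc n)
  have "(\<Sum>j\<in>{..<Suc n} - {i}. f i j) = (\<Sum>j\<in>{..<n} - {i}. f i j) + f i n" if "i < n" for i
  proof -
    have "{..<Suc n} - {i} = insert n ({..<n} - {i})" using that by auto
    then show ?thesis by simp
  qed
  moreover have "(\<Sum>j\<in>{..<Suc n} - {n}. f n j) = (\<Sum>i<n. f i n)"
    by (intro sum.cong) (auto simp: assms[of n])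
  ultimately show ?case using Suc.IH by (simp add: sum.distrib)
qed simp

text \<open>Two distinct coordinates of a product measure are independent.\<close>

lemma distr_PiM_pair:
  assumes M: "\<And>i. i \<in> I \<Longrightarrow> prob_space (M i)" and ij: "i \<in> I" "j \<in> I" "i \<noteq> j"
  shows "distr (Pi\<^sub>M I M) (M i \<Otimes>\<^sub>M M j) (\<lambda>\<omega>. (\<omega> i, \<omega> j)) = M i \<Otimes>\<^sub>M M j"
proof (rule pair_measure_eqI[symmetric])
  fix A B assume AB: "A \<in> sets (M i)" "B \<in> sets (M j)"
  have "(\<lambda>\<omega>. (\<omega> i, \<omega> j)) -` (A \<times> B) \<inter> space (Pi\<^sub>M I M)
      = prod_emb I M {i, j} (\<Pi>\<^sub>E k\<in>{i, j}. if k = i then A else B)"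
    using ij by (auto simp: prod_emb_def space_PiM)
  moreover have "emeasure (Pi\<^sub>M I M) (prod_emb I M {i, j} (\<Pi>\<^sub>E k\<in>{i, j}. if k = i then A else B))
      = emeasure (M i) A * emeasure (M j) B"
    using ij AB by (subst emeasure_PiM_emb) (auto simp: M)
  ultimately show "emeasure (M i) A * emeasure (M j) B
      = emeasure (distr (Pi\<^sub>M I M) (M i \<Otimes>\<^sub>M M j) (\<lambda>\<omega>. (\<omega> i, \<omega> j))) (A \<times> B)"
    using AB ij by (subst emeasure_distr) auto
qed (use ij M prob_space_imp_sigma_finite in auto)

definition pair_energy :: "(real \<Rightarrow> real) \<Rightarrow> real \<Rightarrow> real \<Rightarrow> real" where
  "pair_energy Q x y = (Q x + Q y) / 2 - ln \<bar>x - y\<bar>"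

text \<open>Configurations are finite sets, so that deleting a point needs no relabelling. The sum runs over ordered
  pairs, hence counts each pair twice.\<close>

definition config_energy :: "(real \<Rightarrow> real) \<Rightarrow> real set \<Rightarrow> real" where
  "config_energy Q S = (\<Sum>x\<in>S. \<Sum>y\<in>S - {x}. pair_energy Q x y)"

definition configs :: "nat \<Rightarrow> real set set" where
  "configs n = {S. S \<subseteq> {0..} \<and> finite S \<and> card S = n}"

definition min_energy :: "(real \<Rightarrow> real) \<Rightarrow> nat \<Rightarrow> real" where
  "min_energy Q n = (INF S\<in>configs n. config_energy Q S)"

lemma pair_energy_commute: "pair_energy Q x y = pair_energy Q y x"
  by (simp add: pair_energy_def abs_minus_commute add.commute)

lemma configs_nonempty: "configs n \<noteq> {}"
proof -
  have "real ` {..<n} \<in> configs n"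
    by (auto simp: configs_def card_image)
  then show ?thesis by blast
qed

lemma config_energy_remove:
  assumes "finite S" "z \<in> S"
  shows "config_energy Q (S - {z}) = config_energy Q S - 2 * (\<Sum>y\<in>S - {z}. pair_energy Q z y)"
proof -
  have "(\<Sum>y\<in>S - {x}. pair_energy Q x y)
      = pair_energy Q z x + (\<Sum>y\<in>S - {z} - {x}. pair_energy Q x y)" if "x \<in> S - {z}" for x
  proof -
    have "S - {x} - {z} = S - {z} - {x}" by auto
    then show ?thesis
      using that assms by (subst sum.remove[of _ z]) (auto simp: pair_energy_commute)
  qed
  then show ?thesis
    unfolding config_energy_def
    using assms by (simp add: sum.remove[of S z] sum.distrib)
qed

lemma config_energy_image_sum:
  assumes "inj_on x I"
  shows "config_energy Q (x ` I) = (\<Sum>i\<in>I. \<Sum>j\<in>I - {i}. pair_energy Q (x i) (x j))"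
proof -
  have "config_energy Q (x ` I) = (\<Sum>i\<in>I. \<Sum>y\<in>x ` I - {x i}. pair_energy Q (x i) y)"
    unfolding config_energy_def by (simp add: sum.reindex[OF assms])
  also have "\<dots> = (\<Sum>i\<in>I. \<Sum>j\<in>I - {i}. pair_energy Q (x i) (x j))"
  proof (intro sum.cong refl)
    fix i assume "i \<in> I"
    then have "x ` I - {x i} = x ` (I - {i})"
      using assms by (auto simp: inj_on_def)
    then show "(\<Sum>y\<in>x ` I - {x i}. pair_energy Q (x i) y) = (\<Sum>j\<in>I - {i}. pair_energy Q (x i) (x j))"
      using sum.reindex[OF inj_on_subset[OF assms, of "I - {i}"]] by simp
  qed
  finally show ?thesis .
qed

lemma config_energy_image:
  assumes "inj_on x {..<n}"
  shows "config_energy Q (x ` {..<n})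
    = (real n - 1) * (\<Sum>i<n. Q (x i)) - 2 * (\<Sum>j<n. \<Sum>i<j. ln \<bar>x i - x j\<bar>)"
proof -
  let ?s = "\<Sum>i<n. Q (x i)"
  have "config_energy Q (x ` {..<n}) = (\<Sum>i<n. \<Sum>j\<in>{..<n} - {i}. pair_energy Q (x i) (x j))"
    by (rule config_energy_image_sum[OF assms])
  also have "\<dots> = (\<Sum>i<n. \<Sum>j\<in>{..<n} - {i}. (Q (x i) + Q (x j)) / 2)
      - (\<Sum>i<n. \<Sum>j\<in>{..<n} - {i}. ln \<bar>x i - x j\<bar>)"
    by (simp add: pair_energy_def sum_subtractf)
  also have "(\<Sum>i<n. \<Sum>j\<in>{..<n} - {i}. ln \<bar>x i - x j\<bar>) = 2 * (\<Sum>j<n. \<Sum>i<j. ln \<bar>x i - x j\<bar>)"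
    by (rule sum_offdiagonal) (simp add: abs_minus_commute)
  also have "(\<Sum>i<n. \<Sum>j\<in>{..<n} - {i}. (Q (x i) + Q (x j)) / 2)
      = (\<Sum>i<n. ((real n - 1) * Q (x i) + (?s - Q (x i))) / 2)"
  proof (intro sum.cong refl)
    fix i assume i: "i \<in> {..<n}"
    then have "(\<Sum>j\<in>{..<n} - {i}. Q (x j)) = ?s - Q (x i)"
      by (simp add: sum_diff1)
    then show "(\<Sum>j\<in>{..<n} - {i}. (Q (x i) + Q (x j)) / 2)
        = ((real n - 1) * Q (x i) + (?s - Q (x i))) / 2"
      using i by (simp add: sum.distrib of_nat_diff flip: sum_divide_distrib)
  qed
  also have "\<dots> = (real n - 1) * ?s"
    by (simp add: sum.distrib sum_subtractf flip: sum_divide_distrib sum_distrib_left) (simp add: algebra_simps)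
  finally show ?thesis .
qed

context sqrt_strongly_convex
begin

text \<open>The linear growth of \<open>Q\<close> beats the logarithm: the tangent line of \<open>ln\<close> at \<open>2 / \<rho>\<close> has exactly the
  slope that the confinement can absorb. So the infimum of the energy is finite.\<close>

lemma pair_energy_ge:
  assumes "0 \<le> x" "0 \<le> y" "x \<noteq> y"
  shows "Q 0 + 1 + ln (\<rho> / 2) \<le> pair_energy Q x y"
proof -
  have "ln (\<rho> / 2) + ln \<bar>x - y\<bar> = ln (\<rho> / 2 * \<bar>x - y\<bar>)"
    using assms rho_pos by (subst ln_mult) auto
  also have "\<dots> \<le> \<rho> / 2 * \<bar>x - y\<bar> - 1"
    using assms rho_pos by (intro ln_le_minus_one) auto
  also have "\<dots> \<le> \<rho> / 2 * (x + y) - 1"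
    using assms rho_pos by (intro diff_right_mono mult_left_mono) auto
  finally show ?thesis
    using Q_growth[OF assms(1)] Q_growth[OF assms(2)]
    by (simp add: pair_energy_def field_simps)
qed

lemma bdd_below_config_energy: "bdd_below (config_energy Q ` configs n)"
proof (rule bdd_belowI2)
  fix S assume S: "S \<in> configs n"
  have "(\<Sum>x\<in>S. \<Sum>y\<in>S - {x}. Q 0 + 1 + ln (\<rho> / 2)) \<le> config_energy Q S"
    unfolding config_energy_def using S
    by (intro sum_mono pair_energy_ge) (auto simp: configs_def)
  moreover have "(\<Sum>x\<in>S. \<Sum>y\<in>S - {x}. Q 0 + 1 + ln (\<rho> / 2))
      = real (n * (n - 1)) * (Q 0 + 1 + ln (\<rho> / 2))"
    using S by (simp add: configs_def)
  ultimately show "real (n * (n - 1)) * (Q 0 + 1 + ln (\<rho> / 2)) \<le> config_energy Q S" by (simp only:)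
qed

lemma min_energy_le: "S \<in> configs n \<Longrightarrow> min_energy Q n \<le> config_energy Q S"
  unfolding min_energy_def by (rule cINF_lower[OF bdd_below_config_energy])

text \<open>Delete each point in turn and add up: every pair survives in all but two of the \<open>n + 1\<close>
  deletions. So the minimal energy per ordered pair increases with the number of points.\<close>

lemma min_energy_Suc: "(real n + 1) * min_energy Q n \<le> (real n - 1) * min_energy Q (Suc n)"
  if "n \<ge> 2"
proof -
  have "(real n + 1) * min_energy Q n / (real n - 1) \<le> min_energy Q (Suc n)"
    unfolding min_energy_def[of Q "Suc n"]
  proof (rule cINF_greatest[OF configs_nonempty])
    fix S assume S: "S \<in> configs (Suc n)"
    then have fin: "finite S" by (simp add: configs_def)
    have "(real n + 1) * min_energy Q n = (\<Sum>z\<in>S. min_energy Q n)"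
      using S by (simp add: configs_def algebra_simps)
    also have "\<dots> \<le> (\<Sum>z\<in>S. config_energy Q (S - {z}))"
      using S by (intro sum_mono min_energy_le) (auto simp: configs_def)
    also have "\<dots> = (real n + 1) * config_energy Q S - 2 * config_energy Q S"
      using fin S
      by (simp add: config_energy_remove sum_subtractf configs_def config_energy_def[of Q S] algebra_simps
           flip: sum_distrib_left)
    finally show "(real n + 1) * min_energy Q n / (real n - 1) \<le> config_energy Q S"
      using that by (simp add: field_simps)
  qed
  then show ?thesis using that by (simp add: field_simps)
qed

text \<open>The points of an independent sample of \<open>\<nu>\<close> are almost surely distinct, and the expected energy of the
  sample is \<open>energy Q \<nu>\<close> for each of its \<open>n (n - 1)\<close> ordered pairs.\<close>

lemma min_energy_le_energy:
  assumes \<nu>: "\<nu> \<in> prob_measures_nonneg" and fin: "finite_energy Q \<nu>"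
  shows "min_energy Q n \<le> real n * (real n - 1) * energy Q \<nu>"
proof -
  note D = prob_measures_nonnegD[OF \<nu>]
  interpret prob_space \<nu> by (rule D)
  interpret P: pair_prob_space \<nu> \<nu> ..
  let ?P = "\<Pi>\<^sub>M i\<in>{..<n}. \<nu>"
  interpret PP: prob_space ?P by (intro prob_space_PiM D)
  let ?k = "\<lambda>z. pair_energy Q (fst z) (snd z)"
  have Q: "integrable (\<nu> \<Otimes>\<^sub>M \<nu>) (\<lambda>z. Q (fst z))" "integrable (\<nu> \<Otimes>\<^sub>M \<nu>) (\<lambda>z. Q (snd z))"
    and L: "integrable (\<nu> \<Otimes>\<^sub>M \<nu>) (\<lambda>z. ln \<bar>fst z - snd z\<bar>)"
    and ne: "AE z in \<nu> \<Otimes>\<^sub>M \<nu>. fst z \<noteq> snd z"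
    using fin P.integrable_compose_fst[of Q] P.integrable_compose_snd[of Q]
    by (auto simp: finite_energy_def)
  have k: "integrable (\<nu> \<Otimes>\<^sub>M \<nu>) ?k"
    unfolding pair_energy_def using Q L by simp
  have kint: "(\<integral>z. ?k z \<partial>(\<nu> \<Otimes>\<^sub>M \<nu>)) = energy Q \<nu>"
    unfolding pair_energy_def using Q L fin
    by (simp add: energy_def P.integral_compose_fst P.integral_compose_snd finite_energy_def)
  have pair: "integrable ?P (\<lambda>x. pair_energy Q (x i) (x j))"
    "(\<integral>x. pair_energy Q (x i) (x j) \<partial>?P) = (\<integral>z. ?k z \<partial>(\<nu> \<Otimes>\<^sub>M \<nu>))"
    "AE x in ?P. x i \<noteq> x j" if "i < n" "j < n" "i \<noteq> j" for i j
  proof -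
    have m: "(\<lambda>x. (x i, x j)) \<in> measurable ?P (\<nu> \<Otimes>\<^sub>M \<nu>)"
      using that by auto
    have d: "distr ?P (\<nu> \<Otimes>\<^sub>M \<nu>) (\<lambda>x. (x i, x j)) = \<nu> \<Otimes>\<^sub>M \<nu>"
      using that by (intro distr_PiM_pair[of "{..<n}" "\<lambda>_. \<nu>"] D) auto
    show "integrable ?P (\<lambda>x. pair_energy Q (x i) (x j))"
      using integrable_distr[OF m, of ?k] k by (simp add: d)
    show "(\<integral>x. pair_energy Q (x i) (x j) \<partial>?P) = (\<integral>z. ?k z \<partial>(\<nu> \<Otimes>\<^sub>M \<nu>))"
      using integral_distr[OF m, of ?k] k by (simp add: d)
    show "AE x in ?P. x i \<noteq> x j"
      using AE_distrD[OF m, unfolded d, OF ne] by simp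
  qed
  have "(\<integral>x. (\<Sum>i<n. \<Sum>j\<in>{..<n} - {i}. pair_energy Q (x i) (x j)) \<partial>?P)
      = (\<Sum>i<n. \<integral>x. (\<Sum>j\<in>{..<n} - {i}. pair_energy Q (x i) (x j)) \<partial>?P)"
    using pair(1) by (intro Bochner_Integration.integral_sum Bochner_Integration.integrable_sum) auto
  also have "\<dots> = (\<Sum>i<n. \<Sum>j\<in>{..<n} - {i}. \<integral>x. pair_energy Q (x i) (x j) \<partial>?P)"
    using pair(1) by (intro sum.cong refl Bochner_Integration.integral_sum) auto
  also have "\<dots> = (\<Sum>i<n. \<Sum>j\<in>{..<n} - {i}. energy Q \<nu>)"
    using pair(2) by (intro sum.cong refl) (auto simp: kint)
  also have "\<dots> = real n * (real n - 1) * energy Q \<nu>"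
    by (cases n) auto
  finally have int: "(\<integral>x. (\<Sum>i<n. \<Sum>j\<in>{..<n} - {i}. pair_energy Q (x i) (x j)) \<partial>?P)
      = real n * (real n - 1) * energy Q \<nu>" .
  have "AE x in ?P. \<forall>i<n. \<forall>j<n. i \<noteq> j \<longrightarrow> x i \<noteq> x j"
    using pair(3) by (intro AE_all_countable[THEN iffD2] allI) (auto simp: AE_all_countable)
  then have "AE x in ?P. min_energy Q n \<le> (\<Sum>i<n. \<Sum>j\<in>{..<n} - {i}. pair_energy Q (x i) (x j))"
    using AE_space
  proof eventually_elim
    case (elim x)
    then have inj: "inj_on x {..<n}" by (auto simp: inj_on_def)
    have "x ` {..<n} \<in> configs n"
      using elim(2) D(3) by (auto simp: configs_def card_image[OF inj] space_PiM PiE_iff)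
    then have "min_energy Q n \<le> config_energy Q (x ` {..<n})" by (rule min_energy_le)
    also have "\<dots> = (\<Sum>i<n. \<Sum>j\<in>{..<n} - {i}. pair_energy Q (x i) (x j))"
      by (rule config_energy_image_sum[OF inj])
    finally show ?case .
  qed
  then have "min_energy Q n \<le> (\<integral>x. (\<Sum>i<n. \<Sum>j\<in>{..<n} - {i}. pair_energy Q (x i) (x j)) \<partial>?P)"
    using pair(1) by (intro PP.integral_ge_const Bochner_Integration.integrable_sum) auto
  then show ?thesis by (simp add: int)
qed

end

section \<open>Bounds for the partition function\<close>

definition gibbs_weight :: "(real \<Rightarrow> real) \<Rightarrow> nat \<Rightarrow> (nat \<Rightarrow> real) \<Rightarrow> real" where
  "gibbs_weight Q n x = exp (- real n * (\<Sum>i<n. Q (x i))) * (\<Prod>j<n. \<Prod>i<j. (x i - x j)\<^sup>2)"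

text \<open>The field has the factor \<open>n\<close> in the weight but only \<open>n - 1\<close> in the energy of the configuration; the
  difference is one extra copy of it.\<close>

lemma gibbs_weight_eq:
  assumes "inj_on x {..<n}"
  shows "gibbs_weight Q n x = exp (- config_energy Q (x ` {..<n}) - (\<Sum>i<n. Q (x i)))"
proof -
  have "(\<Prod>j<n. \<Prod>i<j. (x i - x j)\<^sup>2) = (\<Prod>j<n. \<Prod>i<j. exp (2 * ln \<bar>x i - x j\<bar>))"
  proof (intro prod.cong refl)
    fix i j assume "j \<in> {..<n}" "i \<in> {..<j}"
    then have "x i \<noteq> x j" using assms by (auto simp: inj_on_def)
    then have "exp (2 * ln \<bar>x i - x j\<bar>) = \<bar>x i - x j\<bar>\<^sup>2"
      by (simp add: exp_double)
    then show "(x i - x j)\<^sup>2 = exp (2 * ln \<bar>x i - x j\<bar>)" by simp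
  qed
  also have "\<dots> = exp (2 * (\<Sum>j<n. \<Sum>i<j. ln \<bar>x i - x j\<bar>))"
    by (simp add: exp_sum sum_distrib_left)
  finally show ?thesis
    by (simp add: gibbs_weight_def config_energy_image[OF assms] algebra_simps flip: exp_add)
qed

lemma gibbs_weight_nonneg: "0 \<le> gibbs_weight Q n x"
  by (simp add: gibbs_weight_def prod_nonneg)

lemma gibbs_weight_eq_0:
  assumes "\<not> inj_on x {..<n}"
  shows "gibbs_weight Q n x = 0"
proof -
  obtain k l where kl: "k < l" "l < n" "x k = x l"
    using assms unfolding inj_on_def by (metis lessThan_iff linorder_neqE_nat)
  then have "\<exists>i\<in>{..<l}. (x i - x l)\<^sup>2 = 0" by auto
  then have "(\<Prod>i<l. (x i - x l)\<^sup>2) = 0" by (intro prod_zero) auto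
  then have "\<exists>j\<in>{..<n}. (\<Prod>i<j. (x i - x j)\<^sup>2) = 0" using kl(2) by blast
  then have "(\<Prod>j<n. \<Prod>i<j. (x i - x j)\<^sup>2) = 0" by (intro prod_zero) auto
  then show ?thesis by (simp add: gibbs_weight_def)
qed

abbreviation lborel_nonneg :: "real measure" where
  "lborel_nonneg \<equiv> restrict_space lborel {0..}"

interpretation lborel_nonneg_power: product_sigma_finite "\<lambda>_::nat. lborel_nonneg"
  by (intro product_sigma_finite.intro sigma_finite_measure_restrict_space)
    (auto intro: lborel.sigma_finite_measure_axioms)

lemma measurable_lborel_nonneg: "measurable lborel_nonneg M = measurable borel_nonneg M"
  by (intro measurable_cong_sets) (simp_all add: sets_restrict_space)

context sqrt_strongly_convex
begin

lemma gibbs_weight_measurable [measurable]: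
  "gibbs_weight Q n \<in> borel_measurable (\<Pi>\<^sub>M i\<in>{..<n}. lborel_nonneg)"
proof -
  have Q: "Q \<in> borel_measurable lborel_nonneg"
    by (simp add: measurable_lborel_nonneg)
  have id: "(\<lambda>x. x) \<in> borel_measurable lborel_nonneg"
    by (intro measurable_restrict_space1) simp
  have [measurable]: "(\<lambda>x. Q (x i)) \<in> borel_measurable (\<Pi>\<^sub>M i\<in>{..<n}. lborel_nonneg)"
    "(\<lambda>x. x i) \<in> borel_measurable (\<Pi>\<^sub>M i\<in>{..<n}. lborel_nonneg)" if "i < n" for i
    using that by (auto intro: measurable_compose[OF _ Q] measurable_compose[OF _ id])
  show ?thesis
    unfolding gibbs_weight_def
    by (intro borel_measurable_times borel_measurable_exp borel_measurable_sum borel_measurable_prod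
       borel_measurable_power borel_measurable_diff borel_measurable_const) auto
qed

text \<open>Comparison with an exponential density of rate \<open>\<rho>\<close>.\<close>

lemma integrable_exp_minus_Q: "integrable lborel_nonneg (\<lambda>x. exp (- Q x))"
proof -
  have "integrable lborel (exponential_density \<rho>)"
  proof -
    interpret prob_space "density lborel (exponential_density \<rho>)"
      by (rule prob_space_exponential_density[OF rho_pos])
    show ?thesis
      using emeasure_space_1 rho_pos
      by (intro integrableI_nonneg) (auto simp: emeasure_density exponential_density_nonneg)
  qed
  then have "integrable lborel_nonneg (exponential_density \<rho>)"
    by (subst integrable_restrict_space) (auto intro!: integrable_mult_indicator simp del: real_scaleR_def)
  then have "integrable lborel_nonneg (\<lambda>x. exp (- Q 0) / \<rho> * exponential_density \<rho> x)"
    by (rule integrable_mult_right)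
  then show ?thesis
  proof (rule Bochner_Integration.integrable_bound)
    show "(\<lambda>x. exp (- Q x)) \<in> borel_measurable lborel_nonneg"
      by (simp add: measurable_lborel_nonneg)
    show "AE x in lborel_nonneg. norm (exp (- Q x)) \<le> norm (exp (- Q 0) / \<rho> * exponential_density \<rho> x)"
      using Q_growth rho_pos
      by (intro AE_I2) (auto simp: space_restrict_space exponential_density_def algebra_simps simp flip: exp_add)
  qed
qed

text \<open>The extra copy of the field is what keeps the bound integrable.\<close>

lemma gibbs_weight_le:
  assumes "\<And>i. i < n \<Longrightarrow> 0 \<le> x i"
  shows "gibbs_weight Q n x \<le> exp (- min_energy Q n) * (\<Prod>i<n. exp (- Q (x i)))"
proof (cases "inj_on x {..<n}")
  case True
  then have "x ` {..<n} \<in> configs n"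
    using assms by (auto simp: configs_def card_image)
  then show ?thesis
    using min_energy_le[of "x ` {..<n}" n]
    by (simp add: gibbs_weight_eq[OF True] exp_sum[symmetric] sum_negf flip: exp_add)
qed (simp add: gibbs_weight_eq_0 prod_nonneg)

lemma integrable_gibbs_weight: "integrable (\<Pi>\<^sub>M i\<in>{..<n}. lborel_nonneg) (gibbs_weight Q n)"
  and partition_function_le: "partition_function_nonneg Q n
    \<le> exp (- min_energy Q n) * (\<integral>x. exp (- Q x) \<partial>lborel_nonneg) ^ n"
proof -
  let ?P = "\<Pi>\<^sub>M i\<in>{..<n}. lborel_nonneg"
  let ?u = "\<lambda>x. exp (- min_energy Q n) * (\<Prod>i<n. exp (- Q (x i)))"
  have u: "integrable ?P ?u"
    by (intro integrable_mult_right lborel_nonneg_power.product_integrable_prod integrable_exp_minus_Q) auto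
  have le: "gibbs_weight Q n x \<le> ?u x" if "x \<in> space ?P" for x
    using that by (intro gibbs_weight_le) (auto simp: space_PiM space_restrict_space)
  show int: "integrable ?P (gibbs_weight Q n)"
    using u by (rule Bochner_Integration.integrable_bound)
      (use le in \<open>auto intro!: AE_I2 simp: gibbs_weight_nonneg prod_nonneg\<close>)
  have "partition_function_nonneg Q n = (\<integral>x. gibbs_weight Q n x \<partial>?P)"
    by (simp add: partition_function_nonneg_def gibbs_weight_def)
  also have "\<dots> \<le> (\<integral>x. ?u x \<partial>?P)"
    using int u le by (rule integral_mono)
  also have "\<dots> = exp (- min_energy Q n) * (\<integral>x. exp (- Q x) \<partial>lborel_nonneg) ^ n"
    by (subst integral_mult_right_zero, subst lborel_nonneg_power.product_integral_prod)
      (auto simp: integrable_exp_minus_Q)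
  finally show "partition_function_nonneg Q n
    \<le> exp (- min_energy Q n) * (\<integral>x. exp (- Q x) \<partial>lborel_nonneg) ^ n" .
qed

text \<open>Contract the square roots of the points \<open>y i\<close> by the factor \<open>1 - 1 / n\<close> and shift the \<open>i\<close>-th point
  to the right by an amount between \<open>i / n\<^sup>3\<close> and \<open>(i + 1) / n\<^sup>3\<close>. The shifts increase with \<open>i\<close>, so the
  gaps shrink only by the contraction. The square root of a shift is at most \<open>1 / n\<close>, so the square
  root of \<open>x i\<close> is at most \<open>(1 - 1 / n) sqrt (y i) + 1 / n\<close>, and convexity bounds \<open>Q (x i)\<close> by the same
  combination of \<open>Q (y i)\<close> and \<open>Q 1\<close>. With this rate of contraction the factor \<open>n\<close> in front of the field
  drops to \<open>n - 1\<close>, which is precisely what the energy of the configuration contains.\<close>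

lemma gibbs_weight_ge_near_config:
  assumes n: "n \<ge> 2"
    and y: "\<And>i. i < n \<Longrightarrow> 0 \<le> y i" "\<And>i j. i < j \<Longrightarrow> j < n \<Longrightarrow> y i < y j"
    and x: "\<And>i. i < n \<Longrightarrow> (1 - 1 / real n)\<^sup>2 * y i + real i / real n ^ 3 \<le> x i"
      "\<And>i. i < n \<Longrightarrow> x i \<le> (1 - 1 / real n)\<^sup>2 * y i + real (Suc i) / real n ^ 3"
  shows "exp (- config_energy Q (y ` {..<n}) - real n * Q 1) * (1 - 1 / real n) ^ (4 * n * n)
    \<le> gibbs_weight Q n x"
proof -
  define s where "s = 1 / real n"
  have s: "0 < s" "s < 1" "real n * s = 1" using n by (auto simp: s_def)
  have inj: "inj_on y {..<n}"
    using y(2) by (auto simp: inj_on_def) (metis less_irrefl linorder_neqE_nat)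
  have n3: "s\<^sup>2 * s = 1 / real n ^ 3" by (simp add: s_def power3_eq_cube power2_eq_square)
  have Qx: "Q (x i) \<le> (1 - s) * Q (y i) + s * Q 1" if i: "i < n" for i
  proof -
    have "x i \<le> (1 - s)\<^sup>2 * y i + real (Suc i) / real n ^ 3"
      using x(2)[OF i] by (simp add: s_def)
    also have "real (Suc i) / real n ^ 3 \<le> real n / real n ^ 3"
      using i by (intro divide_right_mono) auto
    also have "\<dots> = s\<^sup>2"
      using n by (simp add: s_def power3_eq_cube power2_eq_square)
    also have "(1 - s)\<^sup>2 * y i + s\<^sup>2 \<le> ((1 - s) * sqrt (y i) + s * 1)\<^sup>2"
      using s y(1)[OF i] by (simp add: power2_sum power_mult_distrib)
    finally have "x i \<le> ((1 - s) * sqrt (y i) + s * 1)\<^sup>2" by simp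
    moreover have "0 \<le> x i"
      by (rule order_trans[OF _ x(1)[OF i]]) (use y(1)[OF i] in auto)
    ultimately have "Q (x i) \<le> Q (((1 - s) * sqrt (y i) + s * 1)\<^sup>2)"
      by (intro Q_mono)
    also have "\<dots> \<le> (1 - s) * Q (y i) + s * Q 1"
      using strongly_convex[of s "sqrt (y i)" 1] s rho_pos y(1)[OF i]
      by (smt (verit) mult_nonneg_nonneg one_power2 real_sqrt_pow2 zero_le_power2)
    finally show ?thesis .
  qed
  have "real n * (\<Sum>i<n. Q (x i)) \<le> real n * (\<Sum>i<n. (1 - s) * Q (y i) + s * Q 1)"
    by (intro mult_left_mono sum_mono Qx) auto
  also have "\<dots> = (real n - real n * s) * (\<Sum>i<n. Q (y i)) + real n * (real n * s) * Q 1"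
    by (simp add: sum.distrib flip: sum_distrib_left) (simp add: algebra_simps)
  finally have Q: "real n * (\<Sum>i<n. Q (x i)) \<le> (real n - 1) * (\<Sum>i<n. Q (y i)) + real n * Q 1"
    by (simp add: s)
  have gap: "(1 - s) ^ 4 * (y i - y j)\<^sup>2 \<le> (x i - x j)\<^sup>2" if ij: "i < j" "j < n" for i j
  proof -
    have "real (Suc i) / real n ^ 3 \<le> real j / real n ^ 3"
      using ij by (intro divide_right_mono) auto
    then have "(1 - s)\<^sup>2 * (y j - y i) \<le> x j - x i"
      using x(2)[of i] x(1)[of j] ij by (simp add: s_def algebra_simps)
    then have "((1 - s)\<^sup>2 * (y j - y i))\<^sup>2 \<le> (x j - x i)\<^sup>2"
      using y(2)[OF ij] by (intro power_mono) auto
    then show ?thesis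
      by (simp add: power_mult_distrib power2_commute[of "y j"] power2_commute[of "x j"] flip: power_mult)
  qed
  \<comment> \<open>There are fewer than \<open>n\<^sup>2\<close> pairs; the cruder exponent is harmless, as \<open>(1 - 1 / n) ^ (4 n\<^sup>2)\<close> is still
    \<open>exp (o(n\<^sup>2))\<close>.\<close>
  have "(1 - s) ^ (4 * n * n) * (\<Prod>j<n. \<Prod>i<j. (y i - y j)\<^sup>2)
      = (\<Prod>j<n. ((1 - s) ^ 4) ^ n * (\<Prod>i<j. (y i - y j)\<^sup>2))"
    by (simp add: prod.distrib flip: power_mult)
  also have "\<dots> \<le> (\<Prod>j<n. ((1 - s) ^ 4) ^ j * (\<Prod>i<j. (y i - y j)\<^sup>2))"
    using s by (intro prod_mono conjI mult_right_mono power_decreasing mult_nonneg_nonneg prod_nonneg)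
      (auto intro: power_le_one)
  also have "\<dots> = (\<Prod>j<n. \<Prod>i<j. (1 - s) ^ 4 * (y i - y j)\<^sup>2)"
    by (simp add: prod.distrib)
  also have "\<dots> \<le> (\<Prod>j<n. \<Prod>i<j. (x i - x j)\<^sup>2)"
    using s gap by (intro prod_mono conjI prod_nonneg) auto
  finally have V: "(1 - s) ^ (4 * n * n) * (\<Prod>j<n. \<Prod>i<j. (y i - y j)\<^sup>2)
      \<le> (\<Prod>j<n. \<Prod>i<j. (x i - x j)\<^sup>2)" .
  have "exp (- config_energy Q (y ` {..<n}) - real n * Q 1)
      = exp (- ((real n - 1) * (\<Sum>i<n. Q (y i)) + real n * Q 1)) * exp (real n * (\<Sum>i<n. Q (y i))) * gibbs_weight Q n y"
    by (simp add: gibbs_weight_eq[OF inj] algebra_simps flip: exp_add)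
  also have "\<dots> = exp (- ((real n - 1) * (\<Sum>i<n. Q (y i)) + real n * Q 1)) * (\<Prod>j<n. \<Prod>i<j. (y i - y j)\<^sup>2)"
    by (simp add: gibbs_weight_def exp_minus field_simps)
  finally have "exp (- config_energy Q (y ` {..<n}) - real n * Q 1) * (1 - s) ^ (4 * n * n)
      = exp (- ((real n - 1) * (\<Sum>i<n. Q (y i)) + real n * Q 1))
        * ((1 - s) ^ (4 * n * n) * (\<Prod>j<n. \<Prod>i<j. (y i - y j)\<^sup>2))" by simp
  also have "\<dots> \<le> gibbs_weight Q n x"
    unfolding gibbs_weight_def using Q V s
    by (intro mult_mono) (auto intro!: mult_nonneg_nonneg prod_nonneg)
  finally show ?thesis by (simp add: s_def)
qed

text \<open>Integrate the previous bound over the box of admissible \<open>x\<close>, whose sides have length \<open>1 / n\<^sup>3\<close>.\<close>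

lemma partition_function_ge:
  assumes n: "n \<ge> 2" and S: "S \<in> configs n"
  shows "exp (- config_energy Q S - real n * Q 1) * (1 - 1 / real n) ^ (4 * n * n) * (1 / real n ^ 3) ^ n
    \<le> partition_function_nonneg Q n"
proof -
  let ?P = "\<Pi>\<^sub>M i\<in>{..<n}. lborel_nonneg"
  define y where "y i = sorted_list_of_set S ! i" for i
  have fin: "finite S" and len: "length (sorted_list_of_set S) = n"
    using S by (auto simp: configs_def)
  have yS: "y ` {..<n} = S"
    using set_sorted_list_of_set[OF fin] len by (auto simp: y_def set_conv_nth)
  then have y0: "0 \<le> y i" if "i < n" for i
    using S that by (auto simp: configs_def)
  have y_less: "y i < y j" if "i < j" "j < n" for i j
    using that len strict_sorted_list_of_set[of S] by (auto simp: y_def sorted_wrt_iff_nth_less)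
  define a where "a i = (1 - 1 / real n)\<^sup>2 * y i + real i / real n ^ 3" for i
  define b where "b i = (1 - 1 / real n)\<^sup>2 * y i + real (Suc i) / real n ^ 3" for i
  define A where "A = (\<Pi>\<^sub>E i\<in>{..<n}. {a i..b i})"
  have a0: "0 \<le> a i" if "i < n" for i
    using y0[OF that] by (simp add: a_def)
  have ab: "a i \<le> b i" "b i - a i = 1 / real n ^ 3" for i
    by (auto simp: a_def b_def divide_right_mono diff_divide_distrib[symmetric])
  have sets: "{a i..b i} \<in> sets lborel_nonneg" if "i < n" for i
    using a0[OF that] by (subst sets_restrict_space_iff) auto
  have A: "A \<in> sets ?P"
    unfolding A_def using sets by (intro sets_PiM_I_finite) auto
  have "emeasure ?P A = (\<Prod>i<n. emeasure lborel_nonneg {a i..b i})"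
    unfolding A_def using sets by (intro lborel_nonneg_power.emeasure_PiM) auto
  also have "\<dots> = (\<Prod>i<n. ennreal (1 / real n ^ 3))"
  proof (intro prod.cong refl)
    fix i assume "i \<in> {..<n}"
    then have "{a i..b i} \<subseteq> {0..}" using a0[of i] by auto
    then show "emeasure lborel_nonneg {a i..b i} = ennreal (1 / real n ^ 3)"
      using ab[of i] by (subst emeasure_restrict_space) auto
  qed
  finally have em: "emeasure ?P A = ennreal ((1 / real n ^ 3) ^ n)"
    by (simp add: ennreal_power)
  let ?c = "exp (- config_energy Q S - real n * Q 1) * (1 - 1 / real n) ^ (4 * n * n)"
  have "?c * (1 / real n ^ 3) ^ n = (\<integral>x. ?c * indicator A x \<partial>?P)"
    using A em by (simp add: measure_def)
  also have "\<dots> \<le> (\<integral>x. gibbs_weight Q n x \<partial>?P)"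
  proof (rule integral_mono)
    show "integrable ?P (\<lambda>x. ?c * indicator A x)"
      using A em by (intro integrable_mult_right integrable_real_indicator) auto
    show "?c * indicator A x \<le> gibbs_weight Q n x" for x
    proof (cases "x \<in> A")
      case True
      then have x: "a i \<le> x i" "x i \<le> b i" if "i < n" for i
        using that by (auto simp: A_def PiE_iff)
      show ?thesis
        using gibbs_weight_ge_near_config[OF n, of y x] y0 y_less x True
        by (simp add: yS a_def b_def)
    qed (simp add: gibbs_weight_nonneg)
  qed (rule integrable_gibbs_weight)
  also have "\<dots> = partition_function_nonneg Q n"
    by (simp add: partition_function_nonneg_def gibbs_weight_def)
  finally show ?thesis .
qed

end

section \<open>The limit of the partition functions\<close>

context sqrt_strongly_convex
begin

lemma ln_partition_function_le:
  assumes "n \<ge> 2"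
  shows "ln (partition_function_nonneg Q n)
    \<le> - min_energy Q n + real n * ln (1 + (\<integral>x. exp (- Q x) \<partial>lborel_nonneg))"
proof -
  let ?K = "\<integral>x. exp (- Q x) \<partial>lborel_nonneg"
  have "0 \<le> ?K" by simp
  then have K: "0 < 1 + ?K" by linarith
  obtain S where "S \<in> configs n" using configs_nonempty by blast
  from partition_function_ge[OF assms this]
  have "0 < partition_function_nonneg Q n"
    by (rule less_le_trans[rotated]) (use assms in simp)
  moreover have "partition_function_nonneg Q n \<le> exp (- min_energy Q n) * (1 + ?K) ^ n"
    by (rule order_trans[OF partition_function_le]) (auto intro!: power_mono)
  ultimately have "ln (partition_function_nonneg Q n) \<le> ln (exp (- min_energy Q n) * (1 + ?K) ^ n)"
    by (intro ln_mono)
  also have "\<dots> = - min_energy Q n + real n * ln (1 + ?K)"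
    using K by (simp add: ln_mult_pos ln_realpow)
  finally show ?thesis .
qed

lemma ln_partition_function_ge:
  assumes n: "n \<ge> 2"
  shows "- min_energy Q n - real n * Q 1 + 4 * (real n)\<^sup>2 * ln (1 - 1 / real n) - 3 * real n * ln (real n)
    \<le> ln (partition_function_nonneg Q n)"
proof -
  have "- real n * Q 1 + 4 * (real n)\<^sup>2 * ln (1 - 1 / real n) - 3 * real n * ln (real n)
      - ln (partition_function_nonneg Q n) \<le> min_energy Q n"
    unfolding min_energy_def
  proof (rule cINF_greatest[OF configs_nonempty])
    fix S assume S: "S \<in> configs n"
    let ?r = "exp (- config_energy Q S - real n * Q 1) * (1 - 1 / real n) ^ (4 * n * n) * (1 / real n ^ 3) ^ n"
    have pos: "0 < 1 - 1 / real n" "0 < 1 / real n ^ 3" using n by auto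
    have "ln ?r \<le> ln (partition_function_nonneg Q n)"
      using partition_function_ge[OF n S] pos by (intro ln_mono) auto
    moreover have "ln ?r = - config_energy Q S - real n * Q 1 + real (4 * n * n) * ln (1 - 1 / real n)
        + real n * ln (1 / real n ^ 3)"
      using pos by (simp only: ln_mult_pos mult_pos_pos exp_gt_zero zero_less_power ln_exp ln_realpow)
    moreover have "ln (1 / real n ^ 3) = - 3 * ln (real n)"
      using n by (simp add: ln_div ln_realpow)
    ultimately show "- real n * Q 1 + 4 * (real n)\<^sup>2 * ln (1 - 1 / real n) - 3 * real n * ln (real n)
      - ln (partition_function_nonneg Q n) \<le> config_energy Q S"
      by (simp add: power2_eq_square algebra_simps)
  qed
  then show ?thesis by simp
qed

text \<open>The bounded increasing sequence \<open>min_energy Q n / (n (n - 1))\<close> has a limit \<open>l \<le> energy Q \<nu>\<close>, and the two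
  bounds above squeeze the normalised logarithm of the partition function to \<open>- l\<close>.\<close>

lemma B_nonneg_ge_minus_energy:
  assumes \<nu>: "\<nu> \<in> prob_measures_nonneg" "finite_energy Q \<nu>"
  shows "- energy Q \<nu> \<le> B_nonneg Q"
proof -
  define m where "m n = min_energy Q n / (real n * (real n - 1))" for n
  define K where "K = 1 + (\<integral>x. exp (- Q x) \<partial>lborel_nonneg)"
  have m_le: "m n \<le> energy Q \<nu>" if "n \<ge> 2" for n
    using min_energy_le_energy[OF \<nu>, of n] that by (simp add: m_def field_simps)
  have "incseq (\<lambda>n. m (n + 2))"
  proof (rule incseq_SucI)
    fix n
    have "(real (n + 2) + 1) * min_energy Q (n + 2) \<le> (real (n + 2) - 1) * min_energy Q (Suc (n + 2))"
      by (rule min_energy_Suc) simp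
    then show "m (n + 2) \<le> m (Suc n + 2)"
      by (simp add: m_def divide_simps) (simp add: algebra_simps)
  qed
  then obtain l where "(\<lambda>n. m (n + 2)) \<longlonglongrightarrow> l" and "\<And>n. m (n + 2) \<le> l"
    using incseq_convergent[of "\<lambda>n. m (n + 2)" "energy Q \<nu>"] m_le by auto
  then have ml: "m \<longlonglongrightarrow> l"
    by (rule_tac LIMSEQ_offset[of m 2])
  have l: "l \<le> energy Q \<nu>"
    by (rule LIMSEQ_le_const2[OF ml]) (use m_le in auto)
  define F where "F n = 1 / (real n)\<^sup>2 * ln (partition_function_nonneg Q n)" for n
  \<comment> \<open>The normalisations by \<open>n\<^sup>2\<close> and by the number of ordered pairs differ by a factor tending to \<open>1\<close>.\<close>
  have split: "a / (real n)\<^sup>2 = (1 - 1 / real n) * (a / (real n * (real n - 1)))" if "n \<ge> 2" for a n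
    using that by (simp add: power2_eq_square divide_simps)
  have up: "F n \<le> - ((1 - 1 / real n) * m n) + ln K * (1 / real n)" if "n \<ge> 2" for n
  proof -
    have "F n \<le> 1 / (real n)\<^sup>2 * (- min_energy Q n + real n * ln K)"
      unfolding F_def K_def by (intro mult_left_mono ln_partition_function_le that) auto
    also have "\<dots> = - (min_energy Q n / (real n)\<^sup>2) + ln K * (1 / real n)"
      using that by (simp add: field_simps power2_eq_square)
    finally show ?thesis unfolding m_def split[OF that] .
  qed
  have low: "- ((1 - 1 / real n) * m n) - Q 1 * (1 / real n) + 4 * ln (1 - 1 / real n)
      - 3 * (ln (real n) / real n) \<le> F n" if "n \<ge> 2" for n
  proof -
    have "- (min_energy Q n / (real n)\<^sup>2) - Q 1 * (1 / real n) + 4 * ln (1 - 1 / real n)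
        - 3 * (ln (real n) / real n)
      = 1 / (real n)\<^sup>2 * (- min_energy Q n - real n * Q 1 + 4 * (real n)\<^sup>2 * ln (1 - 1 / real n)
        - 3 * real n * ln (real n))"
      using that by (simp add: field_simps power2_eq_square)
    also have "\<dots> \<le> F n"
      unfolding F_def by (intro mult_left_mono ln_partition_function_ge that) auto
    finally show ?thesis unfolding m_def split[OF that] .
  qed
  note inv = lim_1_over_n[where 'a = real]
  have "(\<lambda>n. - ((1 - 1 / real n) * m n) + ln K * (1 / real n)) \<longlonglongrightarrow> - ((1 - 0) * l) + ln K * 0"
    by (intro tendsto_intros ml inv)
  then have upper: "(\<lambda>n. - ((1 - 1 / real n) * m n) + ln K * (1 / real n)) \<longlonglongrightarrow> - l" by simp
  have "(\<lambda>n. - ((1 - 1 / real n) * m n) - Q 1 * (1 / real n) + 4 * ln (1 - 1 / real n)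
      - 3 * (ln (real n) / real n)) \<longlonglongrightarrow> - ((1 - 0) * l) - Q 1 * 0 + 4 * ln (1 - 0) - 3 * 0"
    by (intro tendsto_intros ml inv lim_ln_over_n) simp
  then have lower: "(\<lambda>n. - ((1 - 1 / real n) * m n) - Q 1 * (1 / real n) + 4 * ln (1 - 1 / real n)
      - 3 * (ln (real n) / real n)) \<longlonglongrightarrow> - l" by simp
  have "F \<longlonglongrightarrow> - l"
    by (rule tendsto_sandwich[OF _ _ lower upper]; rule eventually_sequentiallyI[of 2])
      (use low up in blast)+
  then have "B_nonneg Q = - l"
    unfolding B_nonneg_def F_def[abs_def] by (rule limI)
  then show ?thesis using l by simp
qed

end

section \<open>Displacement convexity\<close>

abbreviation unit_interval :: "real measure" where
  "unit_interval \<equiv> restrict_space lborel {0<..<1}"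

lemma prob_space_unit_interval: "prob_space unit_interval"
  by (auto simp: space_restrict_space emeasure_restrict_space intro!: prob_spaceI)

text \<open>The quantile function \<open>u \<mapsto> Inf {x. u \<le> F x}\<close> of the distribution function \<open>F\<close>.\<close>

lemma quantile_representation:
  assumes \<nu>: "\<nu> \<in> prob_measures_nonneg"
  obtains X where "X \<in> measurable unit_interval borel_nonneg" "mono_on {0<..<1} X"
    "distr unit_interval borel_nonneg X = \<nu>"
proof -
  note D = prob_measures_nonnegD[OF \<nu>]
  interpret \<nu>: prob_space \<nu> by (rule D)
  interpret M: cdf_distribution "distr \<nu> borel (\<lambda>x. x)"
    unfolding cdf_distribution_def using D(4) by (intro \<nu>.real_distribution_distr)
  have nonneg: "0 \<le> M.I u" if "u \<in> {0<..<1}" for u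
  proof (rule ccontr)
    assume "\<not> 0 \<le> M.I u"
    then have "(\<lambda>x. x) -` {..M.I u} \<inter> space \<nu> = {}" by (auto simp: D)
    then have "M.C (M.I u) = 0"
      by (simp add: cdf_def measure_distr D(4))
    moreover have "u \<le> M.C (M.I u)"
      using that by (intro iffD2[OF M.pseudoinverse]) auto
    ultimately show False using that by simp
  qed
  have X: "M.I \<in> measurable unit_interval borel_nonneg"
  proof (rule measurable_restrict_space2)
    show "M.I \<in> space unit_interval \<rightarrow> {0..}" using nonneg by (auto simp: space_restrict_space)
    show "M.I \<in> borel_measurable unit_interval"
      using M.measurable_CI by (simp add: measurable_cong_sets[OF sets_restrict_space_cong[OF sets_lborel] refl])
  qed
  have "distr unit_interval borel_nonneg M.I = \<nu>"
  proof (rule measure_eqI)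
    fix A assume A: "A \<in> sets (distr unit_interval borel_nonneg M.I)"
    then have Ab: "A \<in> sets borel" "A \<subseteq> {0..}"
      by (auto simp: sets_restrict_space_iff)
    have "emeasure (distr unit_interval borel_nonneg M.I) A = emeasure (distr unit_interval borel M.I) A"
      using A X Ab by (simp add: emeasure_distr measurable_restrict_space2_iff)
    also have "\<dots> = emeasure \<nu> A"
      using Ab D by (subst M.distr_I_eq_M) (auto simp: emeasure_distr Int_absorb2)
    finally show "emeasure (distr unit_interval borel_nonneg M.I) A = emeasure \<nu> A" .
  qed (simp add: D)
  then show ?thesis using that[of M.I] X M.mono_I by blast
qed

text \<open>The energy of the law of \<open>X\<close> in terms of \<open>X\<close> and an independent copy.\<close>

lemma
  assumes \<Omega>: "prob_space \<Omega>" and X [measurable]: "X \<in> measurable \<Omega> borel_nonneg"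
    and Q [measurable]: "Q \<in> borel_measurable borel_nonneg"
  shows finite_energy_distr: "finite_energy Q (distr \<Omega> borel_nonneg X) \<longleftrightarrow>
      integrable \<Omega> (\<lambda>u. Q (X u)) \<and>
      integrable (\<Omega> \<Otimes>\<^sub>M \<Omega>) (\<lambda>z. ln \<bar>X (fst z) - X (snd z)\<bar>) \<and>
      (AE z in \<Omega> \<Otimes>\<^sub>M \<Omega>. X (fst z) \<noteq> X (snd z))" (is ?fin)
    and energy_distr: "energy Q (distr \<Omega> borel_nonneg X) = (\<integral>u. Q (X u) \<partial>\<Omega>)
      - (\<integral>z. ln \<bar>X (fst z) - X (snd z)\<bar> \<partial>(\<Omega> \<Otimes>\<^sub>M \<Omega>))" (is ?en)
proof -
  interpret \<Omega>: prob_space \<Omega> by fact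
  let ?N = "distr \<Omega> borel_nonneg X" and ?B = "borel_nonneg \<Otimes>\<^sub>M borel_nonneg :: (real \<times> real) measure"
  interpret N: prob_space ?N by (rule \<Omega>.prob_space_distr[OF X])
  have pair: "?N \<Otimes>\<^sub>M ?N = distr (\<Omega> \<Otimes>\<^sub>M \<Omega>) ?B (\<lambda>(u, v). (X u, X v))"
    by (rule pair_measure_distr) (auto simp: N.sigma_finite_measure_axioms)
  have XX: "(\<lambda>(u, v). (X u, X v)) \<in> measurable (\<Omega> \<Otimes>\<^sub>M \<Omega>) ?B" by measurable
  have id: "(\<lambda>x. x) \<in> borel_measurable borel_nonneg" by (intro measurable_restrict_space1) simp
  have [measurable]: "fst \<in> borel_measurable ?B" "snd \<in> borel_measurable ?B"
    using measurable_compose[OF measurable_fst id] measurable_compose[OF measurable_snd id] by auto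
  have L: "(\<lambda>z. ln \<bar>fst z - snd z\<bar>) \<in> borel_measurable ?B" by measurable
  have ne: "{z \<in> space ?B. fst z \<noteq> snd z} \<in> sets ?B" by measurable
  show ?fin
    unfolding finite_energy_def pair
    by (subst integrable_distr_eq[OF X Q], subst integrable_distr_eq[OF XX L], subst AE_distr_iff[OF XX ne])
      (simp add: split_beta)
  show ?en
    unfolding energy_def pair
    by (subst integral_distr[OF X Q], subst integral_distr[OF XX L]) (simp add: split_beta)
qed

text \<open>Along a motion that keeps the order of two points, the factors \<open>|x - y|\<close> and \<open>x + y\<close> of \<open>|x\<^sup>2 - y\<^sup>2|\<close> are
  affine in time, and \<open>ln\<close> is concave. Without comonotonicity the points could collide.\<close>

lemma ln_diff_squares_interpolation:
  fixes a b c d t :: real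
  assumes nonneg: "0 \<le> a" "0 \<le> b" "0 \<le> c" "0 \<le> d" and t: "0 \<le> t" "t \<le> 1"
    and ne: "a \<noteq> b" "c \<noteq> d" and comonotone: "0 \<le> (a - b) * (c - d)"
  defines "p \<equiv> (1 - t) * a + t * c" and "q \<equiv> (1 - t) * b + t * d"
  shows "p\<^sup>2 \<noteq> q\<^sup>2"
    and "(1 - t) * ln \<bar>a\<^sup>2 - b\<^sup>2\<bar> + t * ln \<bar>c\<^sup>2 - d\<^sup>2\<bar> \<le> ln \<bar>p\<^sup>2 - q\<^sup>2\<bar>"
proof -
  have ln_abs: "ln \<bar>x\<^sup>2 - y\<^sup>2\<bar> = ln \<bar>x - y\<bar> + ln (x + y)" if "0 \<le> x" "0 \<le> y" "x \<noteq> y" for x y :: real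
  proof -
    have "\<bar>x\<^sup>2 - y\<^sup>2\<bar> = \<bar>x - y\<bar> * (x + y)"
      using that by (simp add: power2_eq_square square_diff_square_factored abs_mult)
    then show ?thesis using that by (simp add: ln_mult_pos)
  qed
  have concave: "(1 - t) * ln x + t * ln y \<le> ln ((1 - t) * x + t * y)" if "0 < x" "0 < y" for x y :: real
    using ln_concave that t by (auto simp: concave_on_iff)
  have convex_pos: "0 < (1 - t) * x + t * y" if "0 < x" "0 < y" for x y :: real
    using that t by (cases "t = 0") (auto intro: add_nonneg_pos)
  have sgn: "(a > b \<and> c > d) \<or> (a < b \<and> c < d)"
    using comonotone ne by (auto simp: zero_le_mult_iff)
  have pq: "\<bar>p - q\<bar> = (1 - t) * \<bar>a - b\<bar> + t * \<bar>c - d\<bar>"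
    using sgn
  proof
    assume "a > b \<and> c > d"
    then have "0 < (1 - t) * (a - b) + t * (c - d)" by (intro convex_pos) auto
    moreover have "(1 - t) * (a - b) + t * (c - d) = p - q" by (simp add: p_def q_def algebra_simps)
    ultimately show ?thesis using \<open>a > b \<and> c > d\<close> by simp
  next
    assume "a < b \<and> c < d"
    then have "0 < (1 - t) * (b - a) + t * (d - c)" by (intro convex_pos) auto
    moreover have "(1 - t) * (b - a) + t * (d - c) = q - p" by (simp add: p_def q_def algebra_simps)
    ultimately show ?thesis using \<open>a < b \<and> c < d\<close> by simp
  qed
  moreover have "0 < (1 - t) * \<bar>a - b\<bar> + t * \<bar>c - d\<bar>"
    using ne by (intro convex_pos) auto
  ultimately have "p \<noteq> q" by auto
  moreover have pq0: "0 \<le> p" "0 \<le> q" using nonneg t by (auto simp: p_def q_def)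
  ultimately show "p\<^sup>2 \<noteq> q\<^sup>2" by simp
  have "(1 - t) * ln \<bar>a\<^sup>2 - b\<^sup>2\<bar> + t * ln \<bar>c\<^sup>2 - d\<^sup>2\<bar>
      = ((1 - t) * ln \<bar>a - b\<bar> + t * ln \<bar>c - d\<bar>) + ((1 - t) * ln (a + b) + t * ln (c + d))"
    using nonneg ne by (simp add: ln_abs algebra_simps)
  also have "\<dots> \<le> ln ((1 - t) * \<bar>a - b\<bar> + t * \<bar>c - d\<bar>) + ln ((1 - t) * (a + b) + t * (c + d))"
    using nonneg ne by (intro add_mono concave) auto
  also have "\<dots> = ln \<bar>p - q\<bar> + ln (p + q)"
    by (simp add: pq) (simp add: p_def q_def algebra_simps)
  also have "\<dots> = ln \<bar>p\<^sup>2 - q\<^sup>2\<bar>"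
    using pq0 \<open>p \<noteq> q\<close> by (simp add: ln_abs)
  finally show "(1 - t) * ln \<bar>a\<^sup>2 - b\<^sup>2\<bar> + t * ln \<bar>c\<^sup>2 - d\<^sup>2\<bar> \<le> ln \<bar>p\<^sup>2 - q\<^sup>2\<bar>" .
qed

text \<open>The interpolation is linear in the square roots \<open>Y\<close>, \<open>Z\<close>; squaring returns to the original variable.\<close>

definition sq_interpolation :: "real \<Rightarrow> ('a \<Rightarrow> real) \<Rightarrow> ('a \<Rightarrow> real) \<Rightarrow> 'a \<Rightarrow> real" where
  "sq_interpolation t Y Z u = ((1 - t) * Y u + t * Z u)\<^sup>2"

context sqrt_strongly_convex
begin

text \<open>Both parts of the energy are convex pointwise along the interpolation, and the field contributes the
  quadratic gain. At intermediate times \<open>ln |x - y|\<close> lies between the interpolated logarithms and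
  \<open>x + y\<close>, hence is integrable.\<close>

lemma displacement_convexity:
  fixes \<Omega> :: "'a measure" and Y Z :: "'a \<Rightarrow> real"
  assumes \<Omega>: "prob_space \<Omega>"
    and meas: "Y \<in> borel_measurable \<Omega>" "Z \<in> borel_measurable \<Omega>"
    and nonneg: "\<And>u. u \<in> space \<Omega> \<Longrightarrow> 0 \<le> Y u" "\<And>u. u \<in> space \<Omega> \<Longrightarrow> 0 \<le> Z u"
    and comonotone: "\<And>u v. u \<in> space \<Omega> \<Longrightarrow> v \<in> space \<Omega> \<Longrightarrow> 0 \<le> (Y u - Y v) * (Z u - Z v)"
    and fin: "finite_energy Q (distr \<Omega> borel_nonneg (\<lambda>u. (Y u)\<^sup>2))"
      "finite_energy Q (distr \<Omega> borel_nonneg (\<lambda>u. (Z u)\<^sup>2))"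
    and t: "0 \<le> t" "t \<le> 1"
  defines "\<nu> \<equiv> distr \<Omega> borel_nonneg (sq_interpolation t Y Z)"
  shows "integrable \<Omega> (\<lambda>u. (Y u - Z u)\<^sup>2)"
    and "finite_energy Q \<nu>"
    and "energy Q \<nu> \<le> (1 - t) * energy Q (distr \<Omega> borel_nonneg (\<lambda>u. (Y u)\<^sup>2))
      + t * energy Q (distr \<Omega> borel_nonneg (\<lambda>u. (Z u)\<^sup>2)) - \<rho> * t * (1 - t) * (\<integral>u. (Y u - Z u)\<^sup>2 \<partial>\<Omega>)"
proof -
  note [measurable] = meas
  interpret prob_space \<Omega> by fact
  interpret P: pair_prob_space \<Omega> \<Omega> ..
  let ?P = "\<Omega> \<Otimes>\<^sub>M \<Omega>"
  define X where "X = sq_interpolation t Y Z"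
  have Xm [measurable]: "X \<in> borel_measurable \<Omega>"
    unfolding X_def sq_interpolation_def by measurable
  have to_nonneg: "f \<in> measurable \<Omega> borel_nonneg"
    if "f \<in> borel_measurable \<Omega>" "\<And>u. u \<in> space \<Omega> \<Longrightarrow> 0 \<le> f u" for f
    using that by (intro measurable_restrict_space2) auto
  have mY: "(\<lambda>u. (Y u)\<^sup>2) \<in> measurable \<Omega> borel_nonneg" and mZ: "(\<lambda>u. (Z u)\<^sup>2) \<in> measurable \<Omega> borel_nonneg"
    and mX: "X \<in> measurable \<Omega> borel_nonneg"
    by (auto intro!: to_nonneg simp: X_def[THEN fun_cong, unfolded sq_interpolation_def] Xm)
  note Y = fin(1)[unfolded finite_energy_distr[OF \<Omega> mY Q_measurable]]
  note Z = fin(2)[unfolded finite_energy_distr[OF \<Omega> mZ Q_measurable]]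
  note QX = measurable_compose[OF mX Q_measurable, measurable]
  have QXY: "Q (X u) \<le> (1 - t) * Q ((Y u)\<^sup>2) + t * Q ((Z u)\<^sup>2) - \<rho> * t * (1 - t) * (Y u - Z u)\<^sup>2" for u
    unfolding X_def sq_interpolation_def by (rule strongly_convex[OF t])

  have square: "integrable \<Omega> (\<lambda>u. (V u)\<^sup>2)"
    if V: "integrable \<Omega> (\<lambda>u. Q ((V u)\<^sup>2))" "V \<in> borel_measurable \<Omega>" for V
  proof -
    note [measurable] = V(2)
    have "integrable \<Omega> (\<lambda>u. (Q ((V u)\<^sup>2) - Q 0) / \<rho>)" using V by simp
    then show ?thesis
    proof (rule Bochner_Integration.integrable_bound)
      have "(V u)\<^sup>2 \<le> (Q ((V u)\<^sup>2) - Q 0) / \<rho>" for u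
        using Q_growth[of "(V u)\<^sup>2"] rho_pos by (simp add: field_simps)
      then show "AE u in \<Omega>. norm ((V u)\<^sup>2) \<le> norm ((Q ((V u)\<^sup>2) - Q 0) / \<rho>)"
        by (intro AE_I2) (auto simp del: abs_divide intro: order_trans[OF _ abs_ge_self])
    qed measurable
  qed
  have Y2: "integrable \<Omega> (\<lambda>u. (Y u)\<^sup>2)" and Z2: "integrable \<Omega> (\<lambda>u. (Z u)\<^sup>2)"
    using square[of Y] square[of Z] Y Z meas by auto
  show D: "integrable \<Omega> (\<lambda>u. (Y u - Z u)\<^sup>2)"
  proof (rule Bochner_Integration.integrable_bound)
    show "integrable \<Omega> (\<lambda>u. 2 * (Y u)\<^sup>2 + 2 * (Z u)\<^sup>2)" using Y2 Z2 by simp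
    have "(Y u - Z u)\<^sup>2 \<le> 2 * (Y u)\<^sup>2 + 2 * (Z u)\<^sup>2" for u
      using zero_le_power2[of "Y u + Z u"] by (simp add: power2_eq_square algebra_simps)
    then show "AE u in \<Omega>. norm ((Y u - Z u)\<^sup>2) \<le> norm (2 * (Y u)\<^sup>2 + 2 * (Z u)\<^sup>2)"
      by (intro AE_I2) simp
  qed measurable
  have X_le: "X u \<le> (Y u)\<^sup>2 + (Z u)\<^sup>2" for u
  proof -
    have "X u \<le> (1 - t) * (Y u)\<^sup>2 + t * (Z u)\<^sup>2 - 0"
      unfolding X_def sq_interpolation_def
      using t convex_onD[OF convex_power2, of t "Y u" "Z u"] by simp
    also have "\<dots> \<le> 1 * (Y u)\<^sup>2 + 1 * (Z u)\<^sup>2 - 0"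
      using t by (intro diff_mono add_mono mult_right_mono) auto
    finally show ?thesis by simp
  qed
  have intQX: "integrable \<Omega> (\<lambda>u. Q (X u))"
  proof (rule Bochner_Integration.integrable_bound)
    show "integrable \<Omega> (\<lambda>u. \<bar>Q 0\<bar> + \<bar>(1 - t) * Q ((Y u)\<^sup>2) + t * Q ((Z u)\<^sup>2)\<bar>)"
      using Y Z by (intro Bochner_Integration.integrable_add integrable_abs integrable_const integrable_mult_right) auto
    have "norm (Q (X u)) \<le> norm (\<bar>Q 0\<bar> + \<bar>(1 - t) * Q ((Y u)\<^sup>2) + t * Q ((Z u)\<^sup>2)\<bar>)" for u
    proof -
      have "0 \<le> \<rho> * t * (1 - t) * (Y u - Z u)\<^sup>2" using t rho_pos by simp
      moreover have "Q 0 \<le> Q (X u)" by (intro Q_mono) (auto simp: X_def sq_interpolation_def)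
      ultimately show ?thesis using QXY[of u] by simp
    qed
    then show "AE u in \<Omega>. norm (Q (X u)) \<le> norm (\<bar>Q 0\<bar> + \<bar>(1 - t) * Q ((Y u)\<^sup>2) + t * Q ((Z u)\<^sup>2)\<bar>)"
      by (intro AE_I2)
  qed measurable

  let ?l = "\<lambda>V z. ln \<bar>V (fst z) - V (snd z)\<bar>"
  let ?low = "\<lambda>z. (1 - t) * ?l (\<lambda>u. (Y u)\<^sup>2) z + t * ?l (\<lambda>u. (Z u)\<^sup>2) z"
  let ?up = "\<lambda>z. ((Y (fst z))\<^sup>2 + (Z (fst z))\<^sup>2) + ((Y (snd z))\<^sup>2 + (Z (snd z))\<^sup>2)"
  have low: "integrable ?P ?low"
    using Y Z by (intro Bochner_Integration.integrable_add integrable_mult_right) auto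
  have up: "integrable ?P ?up"
    using P.integrable_compose_fst[OF Bochner_Integration.integrable_add[OF Y2 Z2]]
      P.integrable_compose_snd[OF Bochner_Integration.integrable_add[OF Y2 Z2]]
    by (rule Bochner_Integration.integrable_add)
  have bounds: "AE z in ?P. X (fst z) \<noteq> X (snd z) \<and> ?low z \<le> ?l X z \<and> ?l X z \<le> ?up z"
  proof -
    have "AE z in ?P. (Y (fst z))\<^sup>2 \<noteq> (Y (snd z))\<^sup>2" "AE z in ?P. (Z (fst z))\<^sup>2 \<noteq> (Z (snd z))\<^sup>2"
      using Y Z by auto
    then show ?thesis
      using AE_space
    proof eventually_elim
      case (elim z)
      obtain u v where z: "z = (u, v)" and uv: "u \<in> space \<Omega>" "v \<in> space \<Omega>"
        using elim(3) by (auto simp: space_pair_measure)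
      have ne: "Y u \<noteq> Y v" "Z u \<noteq> Z v" using elim(1,2) by (auto simp: z)
      note I = ln_diff_squares_interpolation[OF nonneg(1)[OF uv(1)] nonneg(1)[OF uv(2)]
          nonneg(2)[OF uv(1)] nonneg(2)[OF uv(2)] t ne comonotone[OF uv],
          folded sq_interpolation_def[of t Y Z], folded X_def]
      have "\<bar>X u - X v\<bar> \<le> ?up z"
        using X_le[of u] X_le[of v] by (auto simp: X_def sq_interpolation_def z abs_le_iff) (smt (verit) zero_le_power2)+
      moreover have "ln \<bar>X u - X v\<bar> \<le> \<bar>X u - X v\<bar>"
        using ln_le_minus_one[of "\<bar>X u - X v\<bar>"] I(1) by simp
      ultimately show ?case using I by (simp add: z)
    qed
  qed
  have intlX: "integrable ?P (?l X)"
  proof (rule Bochner_Integration.integrable_bound)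
    show "integrable ?P (\<lambda>z. \<bar>?low z\<bar> + \<bar>?up z\<bar>)"
      by (rule Bochner_Integration.integrable_add[OF integrable_abs[OF low] integrable_abs[OF up]])
    show "AE z in ?P. norm (?l X z) \<le> norm (\<bar>?low z\<bar> + \<bar>?up z\<bar>)"
      using bounds by eventually_elim (simp only: real_norm_def, arith)
  qed measurable
  show "finite_energy Q \<nu>"
    unfolding \<nu>_def X_def[symmetric] finite_energy_distr[OF \<Omega> mX Q_measurable]
    using intQX intlX bounds by (auto elim: eventually_mono)
  have "(\<integral>u. Q (X u) \<partial>\<Omega>)
      \<le> (\<integral>u. (1 - t) * Q ((Y u)\<^sup>2) + t * Q ((Z u)\<^sup>2) - \<rho> * t * (1 - t) * (Y u - Z u)\<^sup>2 \<partial>\<Omega>)"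
    using intQX Y Z D QXY by (intro integral_mono) auto
  also have "\<dots> = (1 - t) * (\<integral>u. Q ((Y u)\<^sup>2) \<partial>\<Omega>) + t * (\<integral>u. Q ((Z u)\<^sup>2) \<partial>\<Omega>)
      - \<rho> * t * (1 - t) * (\<integral>u. (Y u - Z u)\<^sup>2 \<partial>\<Omega>)"
    using Y Z D by simp
  finally have 1: "(\<integral>u. Q (X u) \<partial>\<Omega>) \<le> \<dots>" .
  have "(\<integral>z. ?low z \<partial>?P) \<le> (\<integral>z. ?l X z \<partial>?P)"
    using low intlX bounds by (intro integral_mono_AE) (auto elim: eventually_mono)
  moreover have "(\<integral>z. ?low z \<partial>?P) = (1 - t) * (\<integral>z. ?l (\<lambda>u. (Y u)\<^sup>2) z \<partial>?P) + t * (\<integral>z. ?l (\<lambda>u. (Z u)\<^sup>2) z \<partial>?P)"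
    using Y Z by simp
  ultimately show "energy Q \<nu> \<le> (1 - t) * energy Q (distr \<Omega> borel_nonneg (\<lambda>u. (Y u)\<^sup>2))
      + t * energy Q (distr \<Omega> borel_nonneg (\<lambda>u. (Z u)\<^sup>2)) - \<rho> * t * (1 - t) * (\<integral>u. (Y u - Z u)\<^sup>2 \<partial>\<Omega>)"
    using 1
    unfolding \<nu>_def X_def[symmetric] energy_distr[OF \<Omega> mX Q_measurable]
      energy_distr[OF \<Omega> mY Q_measurable] energy_distr[OF \<Omega> mZ Q_measurable]
    by (simp add: algebra_simps)
qed

end

section \<open>The transport inequality\<close>

lemma sqrt_quantile:
  assumes \<nu>: "\<nu> \<in> prob_measures_nonneg"
  obtains Y where "Y \<in> borel_measurable unit_interval" "mono_on {0<..<1} Y" "\<And>u. u \<in> {0<..<1} \<Longrightarrow> 0 \<le> Y u"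
    "distr unit_interval borel_nonneg (\<lambda>u. (Y u)\<^sup>2) = \<nu>" "distr unit_interval borel_nonneg Y = hat \<nu>"
proof -
  obtain X where X: "X \<in> measurable unit_interval borel_nonneg" "mono_on {0<..<1} X"
    "distr unit_interval borel_nonneg X = \<nu>"
    using quantile_representation[OF \<nu>] by blast
  have X0: "0 \<le> X u" if "u \<in> {0<..<1}" for u
    using measurable_space[OF X(1), of u] that by (simp add: space_restrict_space)
  have root: "sqrt \<in> measurable borel_nonneg (borel_nonneg :: real measure)"
    by (intro measurable_restrict_space3) auto
  have "(\<lambda>u. sqrt (X u)) \<in> borel_measurable unit_interval"
    using measurable_compose[OF X(1) root] by (simp add: measurable_restrict_space2_iff)
  moreover have "mono_on {0<..<1} (\<lambda>u. sqrt (X u))"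
    using X(2) by (auto simp: mono_on_def)
  moreover have "distr unit_interval borel_nonneg (\<lambda>u. (sqrt (X u))\<^sup>2) = \<nu>"
    unfolding X(3)[symmetric] using X0 by (intro distr_cong) (auto simp: space_restrict_space)
  moreover have "distr unit_interval borel_nonneg (\<lambda>u. sqrt (X u)) = hat \<nu>"
    unfolding hat_def X(3)[symmetric] by (subst distr_distr[OF root X(1)]) (simp add: comp_def)
  ultimately show ?thesis using that[of "\<lambda>u. sqrt (X u)"] X0 by simp
qed

lemma wasserstein_le:
  assumes \<Omega>: "prob_space \<Omega>"
    and Y: "Y \<in> measurable \<Omega> borel_nonneg" and Z: "Z \<in> measurable \<Omega> borel_nonneg"
    and int: "integrable \<Omega> (\<lambda>u. (Y u - Z u)\<^sup>2)"
  shows "wasserstein (distr \<Omega> borel_nonneg Y) (distr \<Omega> borel_nonneg Z)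
    \<le> ereal (sqrt (1 / 2 * (\<integral>u. (Y u - Z u)\<^sup>2 \<partial>\<Omega>)))"
proof -
  let ?B = "borel_nonneg \<Otimes>\<^sub>M borel_nonneg :: (real \<times> real) measure"
  let ?\<mu> = "distr \<Omega> borel_nonneg Y" and ?\<nu> = "distr \<Omega> borel_nonneg Z"
  define \<pi> where "\<pi> = distr \<Omega> ?B (\<lambda>u. (Y u, Z u))"
  interpret \<Omega>: prob_space \<Omega> by fact
  have YZ: "(\<lambda>u. (Y u, Z u)) \<in> measurable \<Omega> ?B" using Y Z by simp
  have sets: "sets (?\<mu> \<Otimes>\<^sub>M ?\<nu>) = sets ?B" by (intro sets_pair_measure_cong) auto
  have "distr \<pi> ?\<mu> fst = distr \<pi> borel_nonneg fst" "distr \<pi> ?\<nu> snd = distr \<pi> borel_nonneg snd"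
    by (auto intro: distr_cong)
  then have "\<pi> \<in> couplings ?\<mu> ?\<nu>"
    unfolding couplings_def using YZ Y Z
    by (simp add: \<pi>_def sets \<Omega>.prob_space_distr distr_distr comp_def)
  then have "wasserstein ?\<mu> ?\<nu> \<le> ereal_sqrt (enn2ereal (\<integral>\<^sup>+ (x, y). ennreal (1 / 2 * (x - y)\<^sup>2) \<partial>\<pi>))"
    unfolding wasserstein_def by (rule INF_lower)
  also have "(\<integral>\<^sup>+ (x, y). ennreal (1 / 2 * (x - y)\<^sup>2) \<partial>\<pi>) = (\<integral>\<^sup>+ u. ennreal (1 / 2 * (Y u - Z u)\<^sup>2) \<partial>\<Omega>)"
  proof -
    have id: "(\<lambda>x. x) \<in> borel_measurable borel_nonneg" by (intro measurable_restrict_space1) simp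
    have [measurable]: "fst \<in> borel_measurable ?B" "snd \<in> borel_measurable ?B"
      using measurable_compose[OF measurable_fst id] measurable_compose[OF measurable_snd id] by auto
    have "(\<lambda>(x, y). ennreal (1 / 2 * (x - y)\<^sup>2)) \<in> borel_measurable ?B"
      unfolding split_beta by measurable
    then show ?thesis
      unfolding \<pi>_def by (subst nn_integral_distr[OF YZ]) auto
  qed
  also have "\<dots> = ennreal (1 / 2 * (\<integral>u. (Y u - Z u)\<^sup>2 \<partial>\<Omega>))"
    using int by (subst nn_integral_eq_integral) auto
  finally show ?thesis by (simp add: ereal_sqrt_def)
qed

context sqrt_strongly_convex
begin

text \<open>Compare the minimiser with the interpolation at time \<open>t\<close>, divide by \<open>t\<close> and let \<open>t\<close> tend to \<open>0\<close>; only the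
  quadratic gain and the difference of the energies remain.\<close>

lemma transport_inequality:
  assumes \<mu>: "\<mu> \<in> prob_measures_nonneg" "finite_energy Q \<mu>"
    and \<nu>: "\<nu> \<in> prob_measures_nonneg" "finite_energy Q \<nu>"
    and min: "\<And>\<nu>'. \<nu>' \<in> prob_measures_nonneg \<Longrightarrow> finite_energy Q \<nu>' \<Longrightarrow> energy Q \<nu> \<le> energy Q \<nu>'"
  shows "wasserstein (hat \<mu>) (hat \<nu>) \<le> ereal (sqrt (1 / (2 * \<rho>) * (energy Q \<mu> - energy Q \<nu>)))"
proof -
  obtain Z where Z: "Z \<in> borel_measurable unit_interval" "mono_on {0<..<1} Z" "\<And>u. u \<in> {0<..<1} \<Longrightarrow> 0 \<le> Z u"
    "distr unit_interval borel_nonneg (\<lambda>u. (Z u)\<^sup>2) = \<mu>" "distr unit_interval borel_nonneg Z = hat \<mu>"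
    using sqrt_quantile[OF \<mu>(1)] by blast
  obtain Y where Y: "Y \<in> borel_measurable unit_interval" "mono_on {0<..<1} Y" "\<And>u. u \<in> {0<..<1} \<Longrightarrow> 0 \<le> Y u"
    "distr unit_interval borel_nonneg (\<lambda>u. (Y u)\<^sup>2) = \<nu>" "distr unit_interval borel_nonneg Y = hat \<nu>"
    using sqrt_quantile[OF \<nu>(1)] by blast
  have sp: "space unit_interval = {0<..<1}" by (simp add: space_restrict_space)
  have comonotone: "0 \<le> (Y u - Y v) * (Z u - Z v)" if "u \<in> {0<..<1}" "v \<in> {0<..<1}" for u v
    using that Y(2) Z(2) by (cases "u \<le> v") (auto simp: mono_on_def intro: mult_nonneg_nonneg mult_nonpos_nonpos)
  note C = displacement_convexity[OF prob_space_unit_interval Y(1) Z(1), unfolded sp Y(4) Z(4),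
      OF Y(3) Z(3) comonotone \<nu>(2) \<mu>(2)]
  let ?D = "\<integral>u. (Y u - Z u)\<^sup>2 \<partial>unit_interval"
  have D: "integrable unit_interval (\<lambda>u. (Y u - Z u)\<^sup>2)"
    using C(1)[of 0] by simp
  \<comment> \<open>The limit \<open>t \<rightarrow> 0\<close> is taken as \<open>s = 1 - t \<rightarrow> 1\<close>.\<close>
  have "s * (\<rho> * ?D) \<le> energy Q \<mu> - energy Q \<nu>" if s: "0 < s" "s < 1" for s
  proof -
    define t where "t = 1 - s"
    have t: "0 < t" "t \<le> 1" using s by (auto simp: t_def)
    let ?\<nu> = "distr unit_interval borel_nonneg (sq_interpolation t Y Z)"
    have "sq_interpolation t Y Z \<in> measurable unit_interval borel_nonneg"
      using Y(1) Z(1) unfolding sq_interpolation_def[abs_def] by (intro measurable_restrict_space2) auto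
    then have "?\<nu> \<in> prob_measures_nonneg"
      by (auto simp: prob_measures_nonneg_def intro: prob_space.prob_space_distr prob_space_unit_interval)
    then have "energy Q \<nu> \<le> energy Q ?\<nu>"
      using C(2)[of t] t by (intro min) auto
    also have "\<dots> \<le> (1 - t) * energy Q \<nu> + t * energy Q \<mu> - \<rho> * t * (1 - t) * ?D"
      using C(3)[of t] t by auto
    finally have "t * (s * (\<rho> * ?D)) \<le> t * (energy Q \<mu> - energy Q \<nu>)"
      by (simp add: t_def algebra_simps)
    then show ?thesis using t by simp
  qed
  then have "\<rho> * ?D \<le> energy Q \<mu> - energy Q \<nu>"
    by (rule field_le_mult_one_interval)
  then have le: "1 / 2 * (\<integral>u. (Z u - Y u)\<^sup>2 \<partial>unit_interval) \<le> 1 / (2 * \<rho>) * (energy Q \<mu> - energy Q \<nu>)"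
    using rho_pos by (simp add: field_simps power2_commute[of "Z _"])
  have "wasserstein (hat \<mu>) (hat \<nu>) \<le> ereal (sqrt (1 / 2 * (\<integral>u. (Z u - Y u)\<^sup>2 \<partial>unit_interval)))"
    unfolding Y(5)[symmetric] Z(5)[symmetric]
    using Y(1,3) Z(1,3) D
    by (intro wasserstein_le prob_space_unit_interval measurable_restrict_space2)
      (auto simp: sp power2_commute[of "Z _"])
  also have "\<dots> \<le> ereal (sqrt (1 / (2 * \<rho>) * (energy Q \<mu> - energy Q \<nu>)))"
    using le by simp
  finally show ?thesis .
qed

end

theorem proposition6p5:
  fixes Q :: "real \<Rightarrow> real" and \<rho> :: real and \<mu> \<mu>\<^sub>Q :: "real measure"
  assumes "\<rho> > 0"
    and "convex_on UNIV (\<lambda>x. Q (x\<^sup>2) - \<rho> * x\<^sup>2)"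
    and "\<mu> \<in> prob_measures_nonneg"
    and "compactly_supported \<mu>"
    and "is_arg_min (rel_free_entropy_nonneg Q) (\<lambda>\<nu>. \<nu> \<in> prob_measures_nonneg) \<mu>\<^sub>Q"
  shows "wasserstein (hat \<mu>) (hat \<mu>\<^sub>Q)
           \<le> ereal_sqrt (ereal (1 / (2 * \<rho>)) * rel_free_entropy_nonneg Q \<mu>)"
proof (cases "rel_free_entropy_nonneg Q \<mu> = \<infinity>")
  case True
  then show ?thesis using assms(1) by (simp add: ereal_sqrt_def)
next
  case False
  interpret sqrt_strongly_convex Q \<rho>
    by standard fact+
  have min: "rel_free_entropy_nonneg Q \<mu>\<^sub>Q \<le> rel_free_entropy_nonneg Q \<nu>"
    if "\<nu> \<in> prob_measures_nonneg" for \<nu>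
    using assms(5) that by (auto simp: is_arg_min_def not_less)
  have \<mu>: "finite_energy Q \<mu>"
    by (rule finite_energy_if_rel_free_entropy_finite[OF assms(3) False])
  have Q: "\<mu>\<^sub>Q \<in> prob_measures_nonneg"
    using assms(5) by (simp add: is_arg_min_def)
  have "rel_free_entropy_nonneg Q \<mu>\<^sub>Q \<noteq> \<infinity>"
    using min[OF assms(3)] False by auto
  then have finQ: "finite_energy Q \<mu>\<^sub>Q"
    by (rule finite_energy_if_rel_free_entropy_finite[OF Q])
  have "wasserstein (hat \<mu>) (hat \<mu>\<^sub>Q) \<le> ereal (sqrt (1 / (2 * \<rho>) * (energy Q \<mu> - energy Q \<mu>\<^sub>Q)))"
    by (rule transport_inequality[OF assms(3) \<mu> Q finQ])
      (use min[unfolded rel_free_entropy_eq_energy[OF finQ]] rel_free_entropy_eq_energy[of Q] in fastforce)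
  also have "\<dots> \<le> ereal (sqrt (1 / (2 * \<rho>) * (energy Q \<mu> + B_nonneg Q)))"
    using B_nonneg_ge_minus_energy[OF Q finQ] assms(1)
    by (auto intro!: divide_right_mono)
  also have "\<dots> = ereal_sqrt (ereal (1 / (2 * \<rho>)) * rel_free_entropy_nonneg Q \<mu>)"
    by (simp add: rel_free_entropy_eq_energy[OF \<mu>] ereal_sqrt_def)
  finally show ?thesis .
qed

end
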